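(* Let $F,G:\mathbb R^d\to\mathbb R^d$ be invertible linear maps, each with $d$ distinct real eigenvalues, $\lambda_1,\dots,\lambda_d$ for $F$ and $t_1,\dots,t_d$ for $G$, with corresponding normalised eigenvectors $\hat e_1,\dots,\hat e_d$ and $\tilde e_1,\dots,\tilde e_d$. Assume that for every $k=1,\dots,d$ the products $\lambda_{i_1}\cdots\lambda_{i_k}$ over distinct $k$-element index sets $\{i_1<\dots<i_k\}\subset\{1,\dots,d\}$ are pairwise different, and likewise for the products $t_{i_1}\cdots t_{i_k}$. Let $A$ be the matrix defined by $\hat e_i=\sum_jA_{ji}\tilde e_j$ and assume $A\in\mathcal M_d$. Let $n_0=\max_{0\le m\le d}\binom dm$. Then the family $\mathcal S_{2n_0^2}(F,G)$ satisfies condition $C(s)$ for all $0\le s\le d$.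
   Context: $\mathcal M_d$ is the class of $d\times d$ matrices all of whose minors (of all sizes) are nonzero. For $k\in\mathbb N$, $\mathcal S_k(F,G)=\{T_1\circ\dots\circ T_j\mid 1\le j\le k,\ T_i\in\{F,G\}\}$. $\Lambda^m$ is the $m$-th exterior power of $\mathbb R^d$ ($\Lambda^0=\mathbb R$) with the standard inner product for which $\{e_{i_1}\wedge\dots\wedge e_{i_m}\mid i_1<\dots<i_m\}$ is orthonormal whenever $\{e_j\}$ is an orthonormal basis; $\Lambda_0^m$ is the set of decomposable $m$-vectors $v_1\wedge\dots\wedge v_m$; linear maps act on $\Lambda^m$ by $S(v_1\wedge\dots\wedge v_m)=Sv_1\wedge\dots\wedge Sv_m$. A family $\{S_i\}_{i\in I}$ satisfies condition $C(m)$ (integer $0\le m\le d$) if for all nonzero $\mathbf v,\mathbf w\in\Lambda_0^m$ there is $i$ with $\langle S_i\mathbf v\mid\mathbf w\rangle\ne0$. For non-integral $0<s<d$ with integer part $m$, it satisfies $C(s)$ if for all nonzero $\mathbf v,\mathbf w\in\Lambda_0^m$ and all $v,w\in\mathbb R^d$ with $\mathbf v\wedge v\ne0$, $\mathbf w\wedge w\ne0$, there is $i$ with $\langle S_i\mathbf v\mid\mathbf w\rangle\ne0$ and $\langle S_i(\mathbf v\wedge v)\mid\mathbf w\wedge w\rangle\ne0$. *)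

theory Defs
  imports "HOL-Analysis.Analysis"
begin

text \<open>Determinant of an m x m matrix given by entries M i j, i,j < m (Leibniz formula,
  same as the library definition of det).\<close>
definition ldet :: "nat \<Rightarrow> (nat \<Rightarrow> nat \<Rightarrow> real) \<Rightarrow> real" where
  "ldet m M = (\<Sum>p\<in>{p. p permutes {..<m}}. of_int (sign p) * (\<Prod>i<m. M i (p i)))"

text \<open>Inner product on the m-th exterior power of two decomposable m-vectors
  v 0 \<and> ... \<and> v (m-1) and w 0 \<and> ... \<and> w (m-1):
  the determinant of the matrix of inner products (standard inner product on Lambda^m).
  For m = 0 both are the element 1 of Lambda^0 = R.\<close>
definition wedge_inner :: "nat \<Rightarrow> (nat \<Rightarrow> real^'n) \<Rightarrow> (nat \<Rightarrow> real^'n) \<Rightarrow> real" where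
  "wedge_inner m v w = ldet m (\<lambda>i j. v i \<bullet> w j)"

text \<open>A decomposable m-vector v 0 \<and> ... \<and> v (m-1) is nonzero iff its squared norm is nonzero.\<close>
definition wedge_nonzero :: "nat \<Rightarrow> (nat \<Rightarrow> real^'n) \<Rightarrow> bool" where
  "wedge_nonzero m v \<longleftrightarrow> wedge_inner m v v \<noteq> 0"

text \<open>Action of a linear map S (matrix) on a decomposable m-vector: S v1 \<and> ... \<and> S vm.\<close>
definition act :: "real^'n^'n \<Rightarrow> (nat \<Rightarrow> real^'n) \<Rightarrow> (nat \<Rightarrow> real^'n)" where
  "act S v = (\<lambda>i. S *v v i)"

text \<open>Condition C(m) for integer m. Nonzero scalar multiples are absorbed into the first
  factor (m \<ge> 1); for m = 0 every nonzero element of Lambda^0 is a nonzero multiple of 1.\<close>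
definition condC_int :: "(real^'n^'n) set \<Rightarrow> nat \<Rightarrow> bool" where
  "condC_int Fam m \<longleftrightarrow>
     (\<forall>v w. wedge_nonzero m v \<and> wedge_nonzero m w \<longrightarrow>
        (\<exists>S\<in>Fam. wedge_inner m (act S v) w \<noteq> 0))"

text \<open>Condition C(s) for non-integral s with integer part m; the (m+1)-vectors
  v \<and> x and w \<and> y are represented by the families v(m := x), w(m := y).\<close>
definition condC_frac :: "(real^'n^'n) set \<Rightarrow> nat \<Rightarrow> bool" where
  "condC_frac Fam m \<longleftrightarrow>
     (\<forall>v w (x::real^'n) y. wedge_nonzero m v \<and> wedge_nonzero m w \<and>
        wedge_nonzero (Suc m) (v(m := x)) \<and> wedge_nonzero (Suc m) (w(m := y)) \<longrightarrow>
        (\<exists>S\<in>Fam. wedge_inner m (act S v) w \<noteq> 0 \<and>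
                  wedge_inner (Suc m) (act S (v(m := x))) (w(m := y)) \<noteq> 0))"

definition condC :: "(real^'n^'n) set \<Rightarrow> real \<Rightarrow> bool" where
  "condC Fam s = (if s \<in> \<int> then condC_int Fam (nat \<lfloor>s\<rfloor>) else condC_frac Fam (nat \<lfloor>s\<rfloor>))"

text \<open>S_k(F,G): all compositions T_1 \<circ> ... \<circ> T_j, 1 \<le> j \<le> k, T_i \<in> {F,G}.\<close>
definition Sk :: "nat \<Rightarrow> real^'n^'n \<Rightarrow> real^'n^'n \<Rightarrow> (real^'n^'n) set" where
  "Sk k F G = {foldr (**) ts (mat 1) | ts. set ts \<subseteq> {F, G} \<and> 1 \<le> length ts \<and> length ts \<le> k}"

text \<open>All minors (of all sizes, any choice of rows and columns) are nonzero.\<close>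
definition all_minors_nonzero :: "real^'n^'n \<Rightarrow> bool" where
  "all_minors_nonzero A \<longleftrightarrow>
     (\<forall>k (r::nat \<Rightarrow> 'n) c. inj_on r {..<k} \<and> inj_on c {..<k} \<longrightarrow>
        ldet k (\<lambda>i j. A $ r i $ c j) \<noteq> 0)"

end

theory Submission
  imports Defs "Jordan_Normal_Form.Determinant"
begin

text \<open>
  The number \<open>\<langle>S v | w\<rangle>\<close> is nonzero iff \<open>S V\<close> meets the orthogonal complement of \<open>W\<close> trivially, where
  \<open>V\<close> and \<open>W\<close> are the subspaces spanned by the factors of \<open>v\<close> and \<open>w\<close>. So for non-integral \<open>s\<close> two
  flags \<open>V \<subseteq> V'\<close> and \<open>U \<subseteq> U'\<close> are given, of dimensions \<open>m, m + 1\<close> and \<open>d - m - 1, d - m\<close>, and a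
  word \<open>S\<close> with \<open>S V \<inter> U' = 0 = S V' \<inter> U\<close> is wanted.

  Transversality is an open condition, so each flag may be replaced by a limit of its images under
  \<open>F ^ (2 * p)\<close> or \<open>G ^ (2 * p)\<close> (inverse powers for \<open>U, U'\<close>). Such limits are spanned by vectors whose
  eigencoordinates live on one modulus of eigenvalues. As products of two eigenvalues are distinct,
  at most one pair of eigenvalues has equal modulus, namely \<open>\<lambda>\<close> and \<open>- \<lambda>\<close>. Hence a limit space is a
  coordinate space, or it contains exactly one line of the plane of that pair; in the latter case
  it may fail to be transversal to a coordinate space of the other basis, but then its image
  under \<open>F\<close> does not fail. Since \<open>m\<close> and \<open>m + 1\<close> cannot both separate the eigenvalues of the pair,
  passing from one basis to the other makes one member of the flag a coordinate space, hence
  invariant, and this leaves enough freedom in the signs to make both intersections trivial.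
  (Expanding \<open>\<langle>G ^ q F ^ p v | w\<rangle>\<close> in eigenvectors only settles a single exterior power: for two of
  them the signs of the eigenvalues can make the product vanish identically.)

  The words act linearly on the tensor product of the exterior powers \<open>m\<close> and \<open>m + 1\<close>, a space of
  dimension \<open>(d choose m) * (d choose (m + 1))\<close>. The span of the images of a vector under words of
  length at most \<open>j\<close> stops growing at some \<open>j\<close> not exceeding that dimension, which bounds the length.
\<close>

section \<open>Determinants and the Cauchy-Binet formula\<close>

no_notation Matrix.vec_index (infixl "$" 100)
no_notation Matrix.scalar_prod (infix "\<bullet>" 70)
hide_const (open) Determinant.det Matrix.mat Matrix.orthogonal

lemma ldet_eq_det: "ldet m M = Determinant.det (Matrix.mat m m (\<lambda>(i, j). M i j))"
proof -
  have "(\<Prod>i<m. M i (p i)) = (\<Prod>i = 0..<m. Matrix.mat m m (\<lambda>(i, j). M i j) $$ (i, p i))"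
    if "p permutes {..<m}" for p
    unfolding lessThan_atLeast0[symmetric]
    using permutes_in_image[OF that] by (intro prod.cong) auto
  then show ?thesis
    unfolding ldet_def Determinant.det_def
    by (auto simp: lessThan_atLeast0 intro!: sum.cong)
qed

text \<open>Nonvanishing is read as triviality of a kernel, with coefficient sequences of which only
  the first \<open>m\<close> entries matter. This is how determinants are tied to linear
  independence below.\<close>

lemma ldet_nonzero_iff_cols:
  "ldet m M \<noteq> 0 \<longleftrightarrow>
    (\<forall>c. (\<forall>i<m. (\<Sum>j<m. M i j * c j) = 0) \<longrightarrow> (\<forall>j<m. c j = 0))"
proof -
  let ?A = "Matrix.mat m m (\<lambda>(i, j). M i j)"
  have A: "?A \<in> carrier_mat m m" by simp
  have prod0: "?A *\<^sub>v Matrix.vec m c = 0\<^sub>v m \<longleftrightarrow> (\<forall>i<m. (\<Sum>j<m. M i j * c j) = 0)" for c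
    by (auto simp: vec_eq_iff Matrix.scalar_prod_def lessThan_atLeast0)
  have vec0: "Matrix.vec m c = 0\<^sub>v m \<longleftrightarrow> (\<forall>j<m. c j = 0)" for c :: "nat \<Rightarrow> real"
    by (auto simp: vec_eq_iff)
  have ex: "(\<exists>v. v \<in> carrier_vec m \<and> P v) \<longleftrightarrow> (\<exists>c. P (Matrix.vec m c))"
    for P :: "real Matrix.vec \<Rightarrow> bool"
  proof
    assume "\<exists>v. v \<in> carrier_vec m \<and> P v"
    then obtain v where v: "v \<in> carrier_vec m" "P v" by blast
    have "v = Matrix.vec m (Matrix.vec_index v)" using v(1) by (intro eq_vecI) auto
    then show "\<exists>c. P (Matrix.vec m c)" using v(2) by metis
  next
    assume "\<exists>c. P (Matrix.vec m c)"
    then show "\<exists>v. v \<in> carrier_vec m \<and> P v" using vec_carrier by blast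
  qed
  show ?thesis
    unfolding ldet_eq_det det_0_iff_vec_prod_zero[OF A] ex prod0 vec0 by blast
qed

lemma ldet_transpose: "ldet m (\<lambda>i j. M j i) = ldet m M"
proof -
  have "Matrix.mat m m (\<lambda>(i, j). M j i) = transpose_mat (Matrix.mat m m (\<lambda>(i, j). M i j))"
    by (rule eq_matI) auto
  then show ?thesis
    unfolding ldet_eq_det by (simp add: Determinant.det_transpose[where n = m])
qed

lemma ldet_nonzero_iff_rows:
  "ldet m M \<noteq> 0 \<longleftrightarrow>
    (\<forall>c. (\<forall>j<m. (\<Sum>i<m. c i * M i j) = 0) \<longrightarrow> (\<forall>i<m. c i = 0))"
  using ldet_nonzero_iff_cols[of m "\<lambda>i j. M j i"] by (simp add: ldet_transpose[of m M] mult.commute)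

lemma ldet_cong:
  assumes "\<And>i j. i < m \<Longrightarrow> j < m \<Longrightarrow> M i j = N i j"
  shows "ldet m M = ldet m N"
proof -
  have "Matrix.mat m m (\<lambda>(i, j). M i j) = Matrix.mat m m (\<lambda>(i, j). N i j)"
    using assms by (intro eq_matI) auto
  then show ?thesis by (simp add: ldet_eq_det)
qed

lemma ldet_permute_rows:
  assumes "p permutes {..<m}"
  shows "ldet m (\<lambda>i j. M (p i) j) = of_int (sign p) * ldet m M"
proof -
  have p: "p permutes {0..<m}" using assms by (simp add: lessThan_atLeast0)
  have "Matrix.mat m m (\<lambda>(i, j). M (p i) j) =
      Matrix.mat m m (\<lambda>(i, j). Matrix.mat m m (\<lambda>(i, j). M i j) $$ (p i, j))"
    using permutes_in_image[OF p] by (intro eq_matI) auto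
  then show ?thesis
    unfolding ldet_eq_det by (simp add: Determinant.det_permute_rows[OF _ p])
qed

lemma ldet_identical_rows:
  assumes "r < m" "s < m" "r \<noteq> s" "\<And>j. j < m \<Longrightarrow> M r j = M s j"
  shows "ldet m M = 0"
proof (rule ccontr)
  assume "ldet m M \<noteq> 0"
  moreover define c where "c i = (if i = r then 1 else 0) - (if i = s then 1 else 0 :: real)" for i
  have "(\<Sum>i<m. c i * M i j) = 0" if "j < m" for j
  proof -
    have "(\<Sum>i<m. c i * M i j) = (\<Sum>i<m. (if i = r then M i j else 0) - (if i = s then M i j else 0))"
      by (rule sum.cong) (auto simp: c_def)
    also have "\<dots> = 0" using assms that by (simp add: sum_subtractf)
    finally show ?thesis .
  qed
  ultimately have "c r = 0"
    using assms(1) unfolding ldet_nonzero_iff_rows by blast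
  with assms(3) show False by (simp add: c_def)
qed

text \<open>The index type carries no order, so an arbitrary enumeration stands in for the
  increasing one. The choice affects a minor only by a sign, which cancels in Cauchy-Binet sums
  because \<open>enum_set I\<close> occurs there in both factors.\<close>

definition enum_set :: "'n set \<Rightarrow> nat \<Rightarrow> 'n" where
  "enum_set I = (SOME h. bij_betw h {..<card I} I)"

lemma bij_betw_enum_set:
  assumes "finite I"
  shows "bij_betw (enum_set I) {..<card I} I"
  using someI_ex[OF ex_bij_betw_nat_finite[OF assms]]
  by (simp only: enum_set_def lessThan_atLeast0)

lemma ldet_expand_rows:
  fixes a :: "nat \<Rightarrow> 'n::finite \<Rightarrow> real"
  shows "ldet m (\<lambda>i j. \<Sum>k\<in>UNIV. a i k * b k j) =
    (\<Sum>f\<in>{..<m} \<rightarrow>\<^sub>E UNIV. (\<Prod>i<m. a i (f i)) * ldet m (\<lambda>i. b (f i)))"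
proof -
  have "ldet m (\<lambda>i j. \<Sum>k\<in>UNIV. a i k * b k j) =
      (\<Sum>p | p permutes {..<m}. \<Sum>f\<in>{..<m} \<rightarrow>\<^sub>E UNIV.
        of_int (sign p) * ((\<Prod>i<m. a i (f i)) * (\<Prod>i<m. b (f i) (p i))))"
    unfolding ldet_def
    by (simp add: prod_sum_PiE prod.distrib sum_distrib_left)
  also have "\<dots> = (\<Sum>f\<in>{..<m} \<rightarrow>\<^sub>E UNIV. (\<Prod>i<m. a i (f i)) * ldet m (\<lambda>i. b (f i)))"
    unfolding ldet_def by (subst sum.swap) (simp add: sum_distrib_left mult_ac)
  finally show ?thesis .
qed

text \<open>An injective \<open>f\<close> is determined by its image \<open>I\<close> and by the
  permutation that compares \<open>f\<close> with the enumeration of \<open>I\<close>.\<close>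

lemma bij_betw_enum_set_permutes:
  "bij_betw (\<lambda>(I, p). restrict (enum_set I \<circ> p) {..<m})
    ({I :: 'n::finite set. card I = m} \<times> {p. p permutes {..<m}})
    {f \<in> {..<m} \<rightarrow>\<^sub>E UNIV. inj_on f {..<m}}"
proof (rule bij_betw_imageI)
  have enum: "bij_betw (enum_set I) {..<m} I" if "card I = m" for I :: "'n set"
    using bij_betw_enum_set[of I] that by simp
  have image: "restrict (enum_set I \<circ> p) {..<m} ` {..<m} = I"
    if "card I = m" "p permutes {..<m}" for I :: "'n set" and p
  proof -
    have "restrict (enum_set I \<circ> p) {..<m} ` {..<m} = enum_set I ` (p ` {..<m})"
      by (simp add: image_image)
    then show ?thesis
      using bij_betw_imp_surj_on[OF enum[OF that(1)]] permutes_image[OF that(2)] by simp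
  qed
  show "inj_on (\<lambda>(I, p). restrict (enum_set I \<circ> p) {..<m})
      ({I :: 'n set. card I = m} \<times> {p. p permutes {..<m}})"
  proof (rule inj_onI)
    fix x y :: "'n set \<times> (nat \<Rightarrow> nat)"
    assume x: "x \<in> {I. card I = m} \<times> {p. p permutes {..<m}}"
      and y: "y \<in> {I. card I = m} \<times> {p. p permutes {..<m}}"
      and xy: "(\<lambda>(I, p). restrict (enum_set I \<circ> p) {..<m}) x = (\<lambda>(I, p). restrict (enum_set I \<circ> p) {..<m}) y"
    obtain I p where Ip: "x = (I, p)" by (cases x)
    obtain J q where Jq: "y = (J, q)" by (cases y)
    have I: "card I = m" "p permutes {..<m}" and J: "card J = m" "q permutes {..<m}"
      using x y by (simp_all add: Ip Jq)
    have eq: "restrict (enum_set I \<circ> p) {..<m} = restrict (enum_set J \<circ> q) {..<m}"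
      using xy by (simp only: Ip Jq prod.case)
    have IJ: "J = I" using image[OF I] image[OF J] unfolding eq by (simp only:)
    have "p i = q i" for i
    proof (cases "i < m")
      case True
      have "enum_set I (p i) = enum_set I (q i)"
        using fun_cong[OF eq, of i] True unfolding IJ by simp
      moreover have "p i < m" "q i < m"
        using permutes_in_image[OF I(2), of i] permutes_in_image[OF J(2), of i] True by simp_all
      ultimately show ?thesis
        using bij_betw_imp_inj_on[OF enum[OF I(1)]] by (auto dest: inj_onD)
    next
      case False
      then show ?thesis using I(2) J(2) by (simp add: permutes_not_in)
    qed
    then show "x = y" unfolding Ip Jq IJ by auto
  qed
  show "(\<lambda>(I, p). restrict (enum_set I \<circ> p) {..<m}) `
      ({I :: 'n set. card I = m} \<times> {p. p permutes {..<m}}) = {f \<in> {..<m} \<rightarrow>\<^sub>E UNIV. inj_on f {..<m}}"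
  proof (intro equalityI subsetI)
    fix f assume "f \<in> (\<lambda>(I, p). restrict (enum_set I \<circ> p) {..<m}) `
      ({I :: 'n set. card I = m} \<times> {p. p permutes {..<m}})"
    then obtain I p where Ip: "card I = m" "p permutes {..<m}" and f: "f = restrict (enum_set I \<circ> p) {..<m}"
      by auto
    have "inj_on (enum_set I \<circ> p) {..<m}"
      using bij_betw_imp_inj_on[OF bij_betw_trans[OF permutes_imp_bij[OF Ip(2)] enum[OF Ip(1)]]] .
    then show "f \<in> {f \<in> {..<m} \<rightarrow>\<^sub>E UNIV. inj_on f {..<m}}" by (auto simp: f inj_on_def)
  next
    fix f :: "nat \<Rightarrow> 'n" assume f: "f \<in> {f \<in> {..<m} \<rightarrow>\<^sub>E UNIV. inj_on f {..<m}}"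
    define I where "I = f ` {..<m}"
    have I: "card I = m" using f by (simp add: I_def card_image)
    define g where "g i = (if i < m then inv_into {..<m} (enum_set I) (f i) else i)" for i
    have "bij_betw (inv_into {..<m} (enum_set I) \<circ> f) {..<m} {..<m}"
      using f by (intro bij_betw_trans[OF _ bij_betw_inv_into[OF enum[OF I]]])
        (auto simp: bij_betw_def I_def)
    then have "bij_betw g {..<m} {..<m}"
      by (rule bij_betw_cong[THEN iffD1, rotated]) (simp add: g_def)
    then have "g permutes {..<m}"
      by (rule bij_imp_permutes) (simp add: g_def)
    moreover have "f = restrict (enum_set I \<circ> g) {..<m}"
    proof
      fix i
      show "f i = restrict (enum_set I \<circ> g) {..<m} i"
        using f bij_betw_imp_surj_on[OF enum[OF I]]
        by (cases "i < m") (auto simp: g_def I_def f_inv_into_f PiE_def extensional_def)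
    qed
    ultimately show "f \<in> (\<lambda>(I, p). restrict (enum_set I \<circ> p) {..<m}) `
      ({I :: 'n set. card I = m} \<times> {p. p permutes {..<m}})"
      using I by (intro image_eqI[of _ _ "(I, g)"]) auto
  qed
qed

text \<open>Multilinearity in the rows expands the determinant over all choices \<open>f\<close>. A
  choice that is not injective repeats a row and contributes 0. The others are grouped by their
  image \<open>I\<close>; for fixed \<open>I\<close> the signed sum over permutations is the Leibniz
  formula of the first factor.\<close>

lemma ldet_Cauchy_Binet:
  fixes a :: "nat \<Rightarrow> 'n::finite \<Rightarrow> real"
  shows "ldet m (\<lambda>i j. \<Sum>k\<in>UNIV. a i k * b k j) =
    (\<Sum>I | card I = m. ldet m (\<lambda>i r. a i (enum_set I r)) * ldet m (\<lambda>r. b (enum_set I r)))"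
proof -
  let ?t = "\<lambda>f. (\<Prod>i<m. a i (f i)) * ldet m (\<lambda>i. b (f i))"
  have fin: "finite ({..<m} \<rightarrow>\<^sub>E (UNIV :: 'n set))" by (simp add: finite_PiE)
  have "ldet m (\<lambda>i j. \<Sum>k\<in>UNIV. a i k * b k j) = sum ?t ({..<m} \<rightarrow>\<^sub>E UNIV)"
    by (rule ldet_expand_rows)
  also have "\<dots> = sum ?t {f \<in> {..<m} \<rightarrow>\<^sub>E UNIV. inj_on f {..<m}}"
  proof (rule sum.mono_neutral_right[OF fin])
    show "\<forall>f\<in>({..<m} \<rightarrow>\<^sub>E UNIV) - {f \<in> {..<m} \<rightarrow>\<^sub>E UNIV. inj_on f {..<m}}. ?t f = 0"
    proof
      fix f :: "nat \<Rightarrow> 'n" assume "f \<in> ({..<m} \<rightarrow>\<^sub>E UNIV) - {f \<in> {..<m} \<rightarrow>\<^sub>E UNIV. inj_on f {..<m}}"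
      then obtain r s where "r < m" "s < m" "r \<noteq> s" "f r = f s"
        by (auto simp: inj_on_def)
      then show "?t f = 0" using ldet_identical_rows[of r m s "\<lambda>i. b (f i)"] by simp
    qed
  qed auto
  also have "\<dots> = (\<Sum>(I, p)\<in>{I. card I = m} \<times> {p. p permutes {..<m}}. ?t (restrict (enum_set I \<circ> p) {..<m}))"
    by (subst sum.reindex_bij_betw[OF bij_betw_enum_set_permutes, symmetric]) (simp add: case_prod_unfold)
  also have "\<dots> = (\<Sum>I | card I = m. \<Sum>p | p permutes {..<m}. ?t (restrict (enum_set I \<circ> p) {..<m}))"
    by (rule sum.cartesian_product[symmetric])
  also have "\<dots> = (\<Sum>I | card I = m. \<Sum>p | p permutes {..<m}.
      (\<Prod>i<m. a i (enum_set I (p i))) * (of_int (sign p) * ldet m (\<lambda>r. b (enum_set I r))))"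
  proof (intro sum.cong refl)
    fix I :: "'n set" and p assume "p \<in> {p. p permutes {..<m}}"
    then have "ldet m (\<lambda>i. b (enum_set I (p i))) = of_int (sign p) * ldet m (\<lambda>r. b (enum_set I r))"
      using ldet_permute_rows[of p m "\<lambda>r. b (enum_set I r)"] by simp
    moreover have "ldet m (\<lambda>i. b (restrict (enum_set I \<circ> p) {..<m} i)) = ldet m (\<lambda>i. b (enum_set I (p i)))"
      by (rule ldet_cong) simp
    ultimately show "?t (restrict (enum_set I \<circ> p) {..<m}) =
      (\<Prod>i<m. a i (enum_set I (p i))) * (of_int (sign p) * ldet m (\<lambda>r. b (enum_set I r)))"
      by simp
  qed
  also have "\<dots> = (\<Sum>I | card I = m. ldet m (\<lambda>i r. a i (enum_set I r)) * ldet m (\<lambda>r. b (enum_set I r)))"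
    unfolding ldet_def[of m "\<lambda>i r. a i (enum_set _ r)"]
    by (simp add: sum_distrib_left mult_ac)
  finally show ?thesis .
qed

section \<open>Shortening words\<close>

text \<open>The spans of the vectors reached by words of length at most \<open>j\<close> increase
  with \<open>j\<close>, and \<open>P\<close> bounds their dimension by \<open>D\<close>. So two
  consecutive ones agree for some \<open>j\<close> up to \<open>D\<close>; that span is invariant
  under every letter and contains the whole orbit.\<close>

lemma word_orbit_in_span_of_short_words:
  fixes f :: "'b \<Rightarrow> 'a::euclidean_space \<Rightarrow> 'a"
  assumes lin: "\<And>t. t \<in> T \<Longrightarrow> linear (f t)"
    and orbit: "\<And>ts. set ts \<subseteq> T \<Longrightarrow> foldr f ts x \<in> P" and dim: "dim P \<le> D"
    and "set ts \<subseteq> T"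
  shows "foldr f ts x \<in> span {foldr f us x | us. set us \<subseteq> T \<and> length us \<le> D}"
proof -
  define B where "B j = {foldr f us x | us. set us \<subseteq> T \<and> length us \<le> j}" for j
  have mono: "B i \<subseteq> B j" if "i \<le> j" for i j
    using that by (auto simp: B_def intro: order_trans)
  have "B j \<subseteq> P" for j using orbit by (auto simp: B_def)
  then have dimB: "dim (B j) \<le> D" for j
    using dim_subset dim le_trans by blast
  have "\<exists>j\<le>D. span (B (Suc j)) = span (B j)"
  proof (rule ccontr)
    assume neq: "\<not> ?thesis"
    \<comment> \<open>If all of the first \<open>D + 1\<close> inclusions were strict,
      \<open>B (Suc D)\<close> would have dimension greater than \<open>D\<close>.\<close>
    have "j \<le> dim (B j)" if "j \<le> Suc D" for j
      using that
    proof (induction j)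
      case (Suc j)
      have "span (B j) \<subset> span (B (Suc j))"
        using neq Suc.prems span_mono[OF mono[of j "Suc j"]] by auto
      then have "dim (B j) < dim (B (Suc j))" by (rule dim_psubset)
      with Suc show ?case by simp
    qed simp
    with dimB[of "Suc D"] show False by fastforce
  qed
  then obtain j where j: "j \<le> D" "span (B (Suc j)) = span (B j)" by blast
  have step: "f t y \<in> span (B j)" if "t \<in> T" "y \<in> span (B j)" for t y
  proof -
    have "f t ` B j \<subseteq> B (Suc j)"
    proof
      fix z assume "z \<in> f t ` B j"
      then obtain us where "set us \<subseteq> T" "length us \<le> j" "z = foldr f (t # us) x"
        by (auto simp: B_def)
      with that(1) show "z \<in> B (Suc j)"
        unfolding B_def by (intro CollectI exI[of _ "t # us"]) auto
    qed
    then have "f t ` span (B j) \<subseteq> span (B (Suc j))"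
      using linear_span_image[OF lin[OF that(1)], of "B j"] span_mono by metis
    with that j(2) show ?thesis by auto
  qed
  have "foldr f ts x \<in> span (B j)"
    using \<open>set ts \<subseteq> T\<close>
  proof (induction ts)
    case Nil
    have "x \<in> B j" unfolding B_def by (intro CollectI exI[of _ "[]"]) auto
    then show ?case by (simp add: span_base)
  qed (use step in auto)
  then show ?thesis using span_mono[OF mono[OF j(1)]] by (auto simp: B_def)
qed

section \<open>Pluecker coordinates and the action on pairs of exterior powers\<close>

definition plucker :: "nat \<Rightarrow> (nat \<Rightarrow> real^'n) \<Rightarrow> 'n set \<Rightarrow> real" where
  "plucker m v I = ldet m (\<lambda>i r. v i $ enum_set I r)"

text \<open>An entry of the \<open>m\<close>-th compound matrix, the matrix of \<open>S\<close> on
  the exterior power. The minor is written transposed, which does not change its value, since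
  Cauchy-Binet yields it in this form.\<close>

definition compound :: "nat \<Rightarrow> real^'n^'n \<Rightarrow> 'n set \<Rightarrow> 'n set \<Rightarrow> real" where
  "compound m S J I = ldet m (\<lambda>r s. S $ enum_set J s $ enum_set I r)"

lemma wedge_inner_plucker:
  "wedge_inner m v w = (\<Sum>I | card I = m. plucker m v I * plucker m w I)"
proof -
  have "wedge_inner m v w = ldet m (\<lambda>i j. \<Sum>k\<in>UNIV. v i $ k * w j $ k)"
    by (simp add: wedge_inner_def inner_vec_def)
  also have "\<dots> = (\<Sum>I | card I = m. ldet m (\<lambda>i r. v i $ enum_set I r) * ldet m (\<lambda>r j. w j $ enum_set I r))"
    by (rule ldet_Cauchy_Binet)
  finally show ?thesis
    unfolding plucker_def ldet_transpose[of m "\<lambda>i r. w i $ enum_set _ r"] .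
qed

lemma plucker_act:
  "plucker m (act S v) J = (\<Sum>I | card I = m. compound m S J I * plucker m v I)"
proof -
  have "plucker m (act S v) J = ldet m (\<lambda>i r. \<Sum>k\<in>UNIV. v i $ k * S $ enum_set J r $ k)"
    by (simp add: plucker_def act_def matrix_vector_mult_def mult.commute)
  also have "\<dots> = (\<Sum>I | card I = m. ldet m (\<lambda>i r. v i $ enum_set I r) *
      ldet m (\<lambda>r s. S $ enum_set J s $ enum_set I r))"
    by (rule ldet_Cauchy_Binet)
  finally show ?thesis by (simp add: plucker_def compound_def mult.commute)
qed

text \<open>The coordinates of \<open>v 0 \<and> \<dots> \<and> v (m - 1) \<otimes> v 0 \<and> \<dots> \<and> v m\<close>.\<close>

definition flag_vec :: "nat \<Rightarrow> (nat \<Rightarrow> real^'n) \<Rightarrow> real^('n set \<times> 'n set)" where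
  "flag_vec m v = (\<chi> q. if card (fst q) = m \<and> card (snd q) = Suc m
      then plucker m v (fst q) * plucker (Suc m) v (snd q) else 0)"

text \<open>The tensor product of two consecutive compounds of \<open>S\<close>. The sum also meets
  pairs \<open>q'\<close> of wrong sizes, where the compound entries are meaningless, but there the
  coordinates of every \<open>flag_vec\<close> are 0.\<close>

definition flag_map :: "nat \<Rightarrow> real^'n^'n \<Rightarrow> real^('n set \<times> 'n set) \<Rightarrow> real^('n set \<times> 'n set)" where
  "flag_map m S z = (\<chi> q. if card (fst q) = m \<and> card (snd q) = Suc m
      then \<Sum>q'\<in>UNIV. compound m S (fst q) (fst q') * compound (Suc m) S (snd q) (snd q') * z $ q'
      else 0)"

lemma linear_flag_map: "linear (flag_map m S)"
proof (rule linearI)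
  show "flag_map m S (x + y) = flag_map m S x + flag_map m S y" for x y
    by (auto simp: flag_map_def Finite_Cartesian_Product.vec_eq_iff distrib_left sum.distrib)
  show "flag_map m S (c *\<^sub>R x) = c *\<^sub>R flag_map m S x" for c x
    by (auto simp: flag_map_def Finite_Cartesian_Product.vec_eq_iff sum_distrib_left mult_ac)
qed

lemma sum_product_card:
  fixes g h :: "'n::finite set \<Rightarrow> real"
  shows "(\<Sum>I | card I = k. g I) * (\<Sum>J | card J = l. h J) =
    (\<Sum>q\<in>UNIV. if card (fst q) = k \<and> card (snd q) = l then g (fst q) * h (snd q) else 0)"
proof -
  have "(\<Sum>I | card I = k. g I) * (\<Sum>J | card J = l. h J) =
      (\<Sum>q\<in>{I. card I = k} \<times> {J. card J = l}. g (fst q) * h (snd q))"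
    by (simp add: sum_product sum.cartesian_product case_prod_unfold)
  also have "\<dots> = (\<Sum>q\<in>UNIV. if q \<in> {I. card I = k} \<times> {J. card J = l} then g (fst q) * h (snd q) else 0)"
    by (subst sum.inter_restrict[symmetric]) auto
  finally show ?thesis by (simp add: mem_Times_iff)
qed

text \<open>The two required inequalities thus become the nonvanishing of a single linear functional
  of \<open>flag_vec m v\<close>.\<close>

lemma flag_vec_inner:
  "flag_vec m v \<bullet> flag_vec m w = wedge_inner m v w * wedge_inner (Suc m) v w"
  unfolding wedge_inner_plucker sum_product_card
  by (auto simp: inner_vec_def flag_vec_def intro!: sum.cong)

lemma flag_vec_act: "flag_vec m (act S v) = flag_map m S (flag_vec m v)"
  unfolding Finite_Cartesian_Product.vec_eq_iff
proof
  fix q :: "'a set \<times> 'a set"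
  show "flag_vec m (act S v) $ q = flag_map m S (flag_vec m v) $ q"
  proof (cases "card (fst q) = m \<and> card (snd q) = Suc m")
    case True
    then have "flag_vec m (act S v) $ q =
        (\<Sum>q'\<in>UNIV. if card (fst q') = m \<and> card (snd q') = Suc m
          then compound m S (fst q) (fst q') * plucker m v (fst q') *
            (compound (Suc m) S (snd q) (snd q') * plucker (Suc m) v (snd q')) else 0)"
      by (simp add: flag_vec_def plucker_act sum_product_card)
    also have "\<dots> = flag_map m S (flag_vec m v) $ q"
      using True by (auto simp: flag_map_def flag_vec_def intro!: sum.cong)
    finally show ?thesis .
  qed (auto simp: flag_vec_def flag_map_def)
qed

lemma dim_flag_vec_space:
  "dim (range (flag_vec m :: (nat \<Rightarrow> real^'n) \<Rightarrow> _)) \<le> (CARD('n) choose m) * (CARD('n) choose Suc m)"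
proof -
  let ?Q = "{I :: 'n set. card I = m} \<times> {J :: 'n set. card J = Suc m}"
  let ?B = "(\<lambda>q. axis q 1) ` ?Q :: (real^('n set \<times> 'n set)) set"
  have "range (flag_vec m :: (nat \<Rightarrow> real^'n) \<Rightarrow> _) \<subseteq> span ?B"
  proof clarify
    fix v :: "nat \<Rightarrow> real^'n"
    have "flag_vec m v = (\<Sum>q\<in>?Q. (flag_vec m v $ q) *\<^sub>R axis q 1)"
      unfolding Finite_Cartesian_Product.vec_eq_iff
    proof
      fix p
      have "(\<Sum>q\<in>?Q. (flag_vec m v $ q) *\<^sub>R axis q 1) $ p = (\<Sum>q\<in>?Q. if q = p then flag_vec m v $ p else 0)"
        unfolding sum_component by (rule sum.cong) (auto simp: axis_def)
      also have "\<dots> = flag_vec m v $ p"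
        by (auto simp: flag_vec_def mem_Times_iff)
      finally show "flag_vec m v $ p = (\<Sum>q\<in>?Q. (flag_vec m v $ q) *\<^sub>R axis q 1) $ p" ..
    qed
    also have "\<dots> \<in> span ?B"
      by (intro span_sum span_scale span_base) auto
    finally show "flag_vec m v \<in> span ?B" .
  qed
  then have "dim (range (flag_vec m :: (nat \<Rightarrow> real^'n) \<Rightarrow> _)) \<le> card ?B"
    by (rule dim_le_card) simp
  also have "\<dots> \<le> card ?Q" by (rule card_image_le) simp
  also have "\<dots> = (CARD('n) choose m) * (CARD('n) choose Suc m)"
    using n_subsets[of "UNIV :: 'n set"] by (simp add: card_cartesian_product)
  finally show ?thesis .
qed

lemma act_mult: "act (S ** T) v = act S (act T v)"
  by (simp add: act_def matrix_vector_mul_assoc)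

lemma act_mat_1 [simp]: "act (mat 1) v = v"
  by (simp add: act_def)

lemma flag_vec_word:
  "flag_vec m (act (foldr (**) ts (mat 1)) v) = foldr (flag_map m) ts (flag_vec m v)"
  by (induction ts) (simp_all add: act_mult flag_vec_act)

text \<open>If every short word failed, its image of \<open>flag_vec m v\<close> would lie in the
  kernel of the functional given by \<open>flag_vec m w\<close>. The kernel is a subspace, so it
  would contain the image under the long word \<open>ts\<close> as well.\<close>

lemma transversal_short_word:
  fixes v w :: "nat \<Rightarrow> real^'n" and ts :: "(real^'n^'n) list" and m :: nat
  defines "D \<equiv> (CARD('n) choose m) * (CARD('n) choose Suc m)"
  assumes ts: "set ts \<subseteq> T"
    and nz: "wedge_inner m (act (foldr (**) ts (mat 1)) v) w \<noteq> 0"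
      "wedge_inner (Suc m) (act (foldr (**) ts (mat 1)) v) w \<noteq> 0"
  shows "\<exists>us. set us \<subseteq> T \<and> length us \<le> D \<and> wedge_inner m (act (foldr (**) us (mat 1)) v) w \<noteq> 0 \<and>
      wedge_inner (Suc m) (act (foldr (**) us (mat 1)) v) w \<noteq> 0"
proof (rule ccontr)
  assume neg: "\<not> ?thesis"
  let ?H = "{z. z \<bullet> flag_vec m w = 0}"
  have "foldr (flag_map m) ts (flag_vec m v) \<in>
      span {foldr (flag_map m) us (flag_vec m v) | us. set us \<subseteq> T \<and> length us \<le> D}"
    using dim_flag_vec_space[where 'n = 'n, of m, folded D_def] ts
    by (intro word_orbit_in_span_of_short_words[where P = "range (flag_vec m)"] linear_flag_map)
      (simp_all flip: flag_vec_word)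
  also have "\<dots> \<subseteq> span ?H"
  proof (rule span_mono, clarify)
    fix us assume "set us \<subseteq> T" "length us \<le> D"
    then show "foldr (flag_map m) us (flag_vec m v) \<bullet> flag_vec m w = 0"
      using neg by (auto simp: flag_vec_inner simp flip: flag_vec_word)
  qed
  also have "\<dots> = ?H"
    by (rule span_eq_iff[THEN iffD2]) (auto simp: subspace_def inner_left_distrib)
  finally show False
    using nz by (simp add: flag_vec_inner flip: flag_vec_word)
qed

section \<open>Linear independence and openness of transversality\<close>

text \<open>Independence of a tuple rather than of a set: repeated entries count as a dependence, as
  they do in a wedge product.\<close>

definition lin_indep :: "nat \<Rightarrow> (nat \<Rightarrow> 'a::real_vector) \<Rightarrow> bool" where
  "lin_indep n x \<longleftrightarrow> (\<forall>c. (\<Sum>i<n. c i *\<^sub>R x i) = 0 \<longrightarrow> (\<forall>i<n. c i = 0))"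

lemma lin_indep_SucD:
  assumes "lin_indep (Suc n) v"
  shows "lin_indep n v"
  unfolding lin_indep_def
proof (intro allI impI)
  fix c i assume "(\<Sum>i<n. c i *\<^sub>R v i) = 0" and i: "i < n"
  then have "(\<Sum>i<Suc n. (if i < n then c i else 0) *\<^sub>R v i) = 0" by simp
  then have "(if i < n then c i else 0) = 0"
    using i by (intro assms[unfolded lin_indep_def, rule_format]) simp_all
  then show "c i = 0" using i by simp
qed

lemma span_image_lessThan:
  fixes x :: "nat \<Rightarrow> 'a::real_vector"
  shows "span (x ` {..<n}) = range (\<lambda>c. \<Sum>i<n. c i *\<^sub>R x i)"
proof
  have "subspace (range (\<lambda>c. \<Sum>i<n. c i *\<^sub>R x i))"
  proof (rule subspaceI)
    show "0 \<in> range (\<lambda>c. \<Sum>i<n. c i *\<^sub>R x i)" by (rule image_eqI[of _ _ "\<lambda>_. 0"]) simp_all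
  next
    fix y z assume "y \<in> range (\<lambda>c. \<Sum>i<n. c i *\<^sub>R x i)" "z \<in> range (\<lambda>c. \<Sum>i<n. c i *\<^sub>R x i)"
    then obtain c d where "y = (\<Sum>i<n. c i *\<^sub>R x i)" "z = (\<Sum>i<n. d i *\<^sub>R x i)" by blast
    then show "y + z \<in> range (\<lambda>c. \<Sum>i<n. c i *\<^sub>R x i)"
      by (intro image_eqI[of _ _ "\<lambda>i. c i + d i"]) (simp_all add: scaleR_left_distrib sum.distrib)
  next
    fix r y assume "y \<in> range (\<lambda>c. \<Sum>i<n. c i *\<^sub>R x i)"
    then obtain c where "y = (\<Sum>i<n. c i *\<^sub>R x i)" by blast
    then show "r *\<^sub>R y \<in> range (\<lambda>c. \<Sum>i<n. c i *\<^sub>R x i)"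
      by (intro image_eqI[of _ _ "\<lambda>i. r * c i"]) (simp_all add: scaleR_sum_right)
  qed
  moreover have "x j \<in> range (\<lambda>c. \<Sum>i<n. c i *\<^sub>R x i)" if "j < n" for j
  proof (rule image_eqI[of _ _ "\<lambda>i. if i = j then 1 else 0"])
    show "x j = (\<Sum>i<n. (if i = j then 1 else 0) *\<^sub>R x i)"
      using that by (simp add: if_distrib[of "\<lambda>r. r *\<^sub>R _"] cong: if_cong)
  qed simp
  ultimately show "span (x ` {..<n}) \<subseteq> range (\<lambda>c. \<Sum>i<n. c i *\<^sub>R x i)"
    by (intro span_minimal) auto
  show "range (\<lambda>c. \<Sum>i<n. c i *\<^sub>R x i) \<subseteq> span (x ` {..<n})"
    by (auto intro: span_sum span_scale span_base)
qed

lemma lin_indep_iff_dim: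
  fixes x :: "nat \<Rightarrow> 'a::euclidean_space"
  shows "lin_indep n x \<longleftrightarrow> dim (x ` {..<n}) = n"
proof
  assume x: "lin_indep n x"
  have inj: "inj_on x {..<n}"
  proof (rule inj_onI, rule ccontr)
    fix i j assume ij: "i \<in> {..<n}" "j \<in> {..<n}" "x i = x j" "i \<noteq> j"
    define c where "c k = (if k = i then 1 else 0) - (if k = j then 1 else 0 :: real)" for k
    have "(\<Sum>k<n. c k *\<^sub>R x k) = (\<Sum>k<n. (if k = i then x k else 0) - (if k = j then x k else 0))"
      by (rule sum.cong) (auto simp: c_def)
    also have "\<dots> = 0" using ij by (simp add: sum_subtractf)
    finally have "c i = 0" using x ij by (auto simp: lin_indep_def)
    with ij show False by (simp add: c_def)
  qed
  have "independent (x ` {..<n})"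
  proof (rule independent_if_scalars_zero)
    fix f y assume 0: "(\<Sum>z\<in>x ` {..<n}. f z *\<^sub>R z) = 0" and y: "y \<in> x ` {..<n}"
    have "(\<Sum>i<n. f (x i) *\<^sub>R x i) = 0"
      using 0 by (simp add: sum.reindex[OF inj])
    then have "\<forall>i<n. f (x i) = 0" using x by (auto simp: lin_indep_def)
    with y show "f y = 0" by auto
  qed simp
  then show "dim (x ` {..<n}) = n"
    using inj by (simp add: dim_eq_card_independent card_image)
next
  assume d: "dim (x ` {..<n}) = n"
  have "card (x ` {..<n}) \<le> n" using card_image_le[of "{..<n}" x] by simp
  then have ind: "independent (x ` {..<n})"
    using d by (intro card_le_dim_spanning[of _ "x ` {..<n}"]) (auto intro: span_base)
  then have "card (x ` {..<n}) = n" using d by (simp add: dim_eq_card_independent)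
  then have inj: "inj_on x {..<n}" by (intro eq_card_imp_inj_on) simp_all
  show "lin_indep n x" unfolding lin_indep_def
  proof (intro allI impI)
    fix c i assume 0: "(\<Sum>i<n. c i *\<^sub>R x i) = 0" and i: "i < n"
    let ?u = "\<lambda>y. c (inv_into {..<n} x y)"
    have "(\<Sum>y\<in>x ` {..<n}. ?u y *\<^sub>R y) = (\<Sum>i<n. c i *\<^sub>R x i)"
      using inj by (simp add: sum.reindex)
    then have "?u (x i) = 0"
      using independentD[OF ind _ order_refl, of ?u "x i"] 0 i by simp
    then show "c i = 0" using inj i by simp
  qed
qed

text \<open>The Gram matrix is singular iff some nontrivial combination of coefficients gives a
  vector orthogonal to all \<open>x j\<close>; such a vector is orthogonal to itself, hence
  0.\<close>

lemma wedge_nonzero_iff_lin_indep: "wedge_nonzero n x \<longleftrightarrow> lin_indep n x"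
proof -
  have gram: "(\<Sum>i<n. c i * (x i \<bullet> x j)) = (\<Sum>i<n. c i *\<^sub>R x i) \<bullet> x j" for c j
    by (simp add: inner_sum_left)
  have "(\<forall>j<n. (\<Sum>i<n. c i *\<^sub>R x i) \<bullet> x j = 0) \<longleftrightarrow> (\<Sum>i<n. c i *\<^sub>R x i) = 0" (is "?L \<longleftrightarrow> ?R") for c
  proof
    assume ?L
    then have "(\<Sum>i<n. c i *\<^sub>R x i) \<bullet> (\<Sum>j<n. c j *\<^sub>R x j) = 0"
      unfolding inner_sum_right[of _ "\<lambda>j. c j *\<^sub>R x j"] by simp
    then show ?R by simp
  qed simp
  then show ?thesis
    unfolding wedge_nonzero_def wedge_inner_def ldet_nonzero_iff_rows gram lin_indep_def by simp
qed

lemma wedge_inner_nonzeroI: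
  assumes "lin_indep m v" and "\<And>x. x \<in> span (v ` {..<m}) \<Longrightarrow> (\<And>j. j < m \<Longrightarrow> x \<bullet> w j = 0) \<Longrightarrow> x = 0"
  shows "wedge_inner m v w \<noteq> 0"
  unfolding wedge_inner_def ldet_nonzero_iff_rows
proof (rule allI, rule impI)
  fix c assume c: "\<forall>j<m. (\<Sum>i<m. c i * (v i \<bullet> w j)) = 0"
  have "(\<Sum>i<m. c i *\<^sub>R v i) = 0"
  proof (rule assms(2))
    show "(\<Sum>i<m. c i *\<^sub>R v i) \<in> span (v ` {..<m})" by (auto simp: span_image_lessThan)
    show "(\<Sum>i<m. c i *\<^sub>R v i) \<bullet> w j = 0" if "j < m" for j
      using c that by (simp add: inner_sum_left)
  qed
  with assms(1) show "\<forall>i<m. c i = 0" by (auto simp: lin_indep_def)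
qed

abbreviation transversal :: "'a::zero set \<Rightarrow> 'a set \<Rightarrow> bool" where
  "transversal X Y \<equiv> X \<inter> Y \<subseteq> {0}"

lemma linear_projection_kernel:
  fixes U :: "'a::euclidean_space set"
  assumes "subspace U"
  obtains P :: "'a \<Rightarrow> 'a" where "linear P" "\<And>x. P x = 0 \<longleftrightarrow> x \<in> U"
proof -
  obtain B where B: "B \<subseteq> U" "pairwise orthogonal B" "\<And>b. b \<in> B \<Longrightarrow> norm b = 1"
    "independent B" "span B = U"
    using orthonormal_basis_subspace[OF assms] by metis
  have fin: "finite B" using B(4) by (rule finiteI_independent)
  define P where "P x = x - (\<Sum>b\<in>B. (x \<bullet> b) *\<^sub>R b)" for x
  have "linear P"
    unfolding P_def
    by (rule linearI)
      (simp_all add: inner_left_distrib scaleR_left_distrib sum.distrib scaleR_right_diff_distrib scaleR_sum_right)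
  moreover have "P x = 0 \<longleftrightarrow> x \<in> U" for x
  proof
    assume "P x = 0"
    then have "x = (\<Sum>b\<in>B. (x \<bullet> b) *\<^sub>R b)" by (simp add: P_def)
    also have "\<dots> \<in> span B" by (intro span_sum span_scale span_base)
    finally show "x \<in> U" using B(5) by simp
  next
    assume "x \<in> U"
    then show "P x = 0"
      using orthonormal_basis_expand[OF B(2,3) _ fin] B(5) by (simp add: P_def)
  qed
  ultimately show thesis by (rule that)
qed

text \<open>A linear \<open>P\<close> with kernel \<open>U\<close> turns transversality into
  independence of the vectors \<open>P (l i)\<close>, that is, into a nonzero Gram determinant. This
  determinant is continuous in the vectors, so it stays nonzero for nearby tuples.\<close>

lemma eventually_transversal:
  fixes l :: "nat \<Rightarrow> real^'n"
  assumes U: "subspace U" and l: "lin_indep n l" "transversal (span (l ` {..<n})) U"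
    and lim: "\<And>i. i < n \<Longrightarrow> (\<lambda>p. y p i) \<longlonglongrightarrow> l i"
  shows "\<forall>\<^sub>F p in sequentially. transversal (span (y p ` {..<n})) U"
proof -
  obtain P :: "real^'n \<Rightarrow> real^'n" where P: "linear P" "\<And>x. P x = 0 \<longleftrightarrow> x \<in> U"
    using linear_projection_kernel[OF U] by blast
  have P_sum: "P (\<Sum>i<n. c i *\<^sub>R z i) = (\<Sum>i<n. c i *\<^sub>R P (z i))" for c z
    by (simp add: linear_sum[OF P(1)] linear_cmul[OF P(1)])
  have "lin_indep n (\<lambda>i. P (l i))"
    unfolding lin_indep_def
  proof (rule allI, rule impI)
    fix c assume "(\<Sum>i<n. c i *\<^sub>R P (l i)) = 0"
    then have "(\<Sum>i<n. c i *\<^sub>R l i) \<in> U" by (simp flip: P_sum P(2))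
    moreover have "(\<Sum>i<n. c i *\<^sub>R l i) \<in> span (l ` {..<n})" by (auto simp: span_image_lessThan)
    ultimately have "(\<Sum>i<n. c i *\<^sub>R l i) = 0" using l(2) by blast
    then show "\<forall>i<n. c i = 0" using l(1) by (auto simp: lin_indep_def)
  qed
  then have nz: "wedge_inner n (\<lambda>i. P (l i)) (\<lambda>i. P (l i)) \<noteq> 0"
    by (simp add: wedge_nonzero_iff_lin_indep flip: wedge_nonzero_def)
  have limP: "(\<lambda>p. P (y p i)) \<longlonglongrightarrow> P (l i)" if "i < n" for i
    using bounded_linear.tendsto[OF _ lim[OF that], of P] P(1) by (simp add: linear_conv_bounded_linear)
  have "(\<lambda>p. wedge_inner n (\<lambda>i. P (y p i)) (\<lambda>i. P (y p i))) \<longlonglongrightarrow>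
      wedge_inner n (\<lambda>i. P (l i)) (\<lambda>i. P (l i))"
    unfolding wedge_inner_def ldet_def
  proof (intro tendsto_sum tendsto_mult tendsto_const tendsto_prod tendsto_inner)
    fix q i assume q: "q \<in> {q. q permutes {..<n}}" and i: "i \<in> {..<n}"
    show "(\<lambda>p. P (y p i)) \<longlonglongrightarrow> P (l i)" using i limP by simp
    show "(\<lambda>p. P (y p (q i))) \<longlonglongrightarrow> P (l (q i))"
      using limP q i permutes_in_image[of q "{..<n}" i] by simp
  qed
  then have "\<forall>\<^sub>F p in sequentially. wedge_inner n (\<lambda>i. P (y p i)) (\<lambda>i. P (y p i)) \<noteq> 0"
    using nz by (rule tendsto_imp_eventually_ne)
  then show ?thesis
  proof eventually_elim
    case (elim p)
    then have ind: "lin_indep n (\<lambda>i. P (y p i))"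
      by (simp add: wedge_nonzero_def flip: wedge_nonzero_iff_lin_indep)
    show ?case
    proof clarify
      fix x assume "x \<in> span (y p ` {..<n})" and xU: "x \<in> U"
      then obtain c where x: "x = (\<Sum>i<n. c i *\<^sub>R y p i)" by (auto simp: span_image_lessThan)
      have "(\<Sum>i<n. c i *\<^sub>R P (y p i)) = 0" using xU unfolding P(2)[symmetric] x P_sum .
      then have "\<forall>i<n. c i = 0" using ind by (auto simp: lin_indep_def)
      then show "x = 0" by (simp add: x)
    qed
  qed
qed

section \<open>Eigenbases and limits of flags\<close>

text \<open>\<open>C j\<close> is the coordinate functional belonging to \<open>e j\<close>. The
  axiom \<open>abs_lam_pair\<close> records the consequence of the product hypothesis used for
  limits: at most one pair of eigenvalues shares a modulus.\<close>

locale eigenbasis =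
  fixes F :: "real^'n^'n" and e :: "'n \<Rightarrow> real^'n" and lam :: "'n \<Rightarrow> real"
    and C :: "'n \<Rightarrow> real^'n \<Rightarrow> real"
  assumes linear_coord: "linear (C j)"
    and expand: "x = (\<Sum>j\<in>UNIV. C j x *\<^sub>R e j)"
    and coord_basis: "C j (e k) = (if j = k then 1 else 0)"
    and eigenvector: "F *v e i = lam i *\<^sub>R e i"
    and lam_nonzero: "lam i \<noteq> 0"
    and inj_lam: "inj lam"
    and abs_lam_pair: "\<lbrakk>\<bar>lam i\<bar> = \<bar>lam j\<bar>; i \<noteq> j; \<bar>lam k\<bar> = \<bar>lam l\<bar>; k \<noteq> l\<rbrakk> \<Longrightarrow> {i, j} = {k, l}"
begin

lemma coord_sum: "C j (\<Sum>i\<in>A. f i) = (\<Sum>i\<in>A. C j (f i))"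
  by (rule linear_sum[OF linear_coord])

lemma coord_simps [simp]:
  "C j 0 = 0" "C j (x + y) = C j x + C j y" "C j (x - y) = C j x - C j y" "C j (r *\<^sub>R x) = r * C j x"
  using linear_0[OF linear_coord] linear_add[OF linear_coord] linear_diff[OF linear_coord]
    linear_cmul[OF linear_coord] by auto

lemma coord_eqI: "(\<And>j. C j x = C j y) \<Longrightarrow> x = y"
  using expand[of x] expand[of y] by simp

lemma coord_basis_sum: "C j (\<Sum>k\<in>A. f k *\<^sub>R e k) = (if j \<in> A then f j else 0)"
proof -
  have "C j (\<Sum>k\<in>A. f k *\<^sub>R e k) = (\<Sum>k\<in>A. if j = k then f k else 0)"
    unfolding coord_sum by (rule sum.cong) (auto simp: coord_basis)
  then show ?thesis by simp
qed

lemma coord_apply: "C j (F *v x) = lam j * C j x"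
proof -
  have "F *v x = (\<Sum>k\<in>UNIV. (lam k * C k x) *\<^sub>R e k)"
    by (subst expand[of x])
      (simp add: linear_sum[OF matrix_vector_mul_linear] matrix_vector_mult_scaleR eigenvector mult.commute)
  then show ?thesis by (simp only: coord_basis_sum) simp
qed

lemma mem_span_basis: "x \<in> span (e ` I) \<longleftrightarrow> (\<forall>j. j \<notin> I \<longrightarrow> C j x = 0)"
proof
  have "subspace {x. \<forall>j. j \<notin> I \<longrightarrow> C j x = 0}" by (auto simp: subspace_def)
  moreover have "e ` I \<subseteq> {x. \<forall>j. j \<notin> I \<longrightarrow> C j x = 0}" by (auto simp: coord_basis)
  ultimately show "x \<in> span (e ` I) \<Longrightarrow> \<forall>j. j \<notin> I \<longrightarrow> C j x = 0"
    using span_minimal by blast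
next
  assume "\<forall>j. j \<notin> I \<longrightarrow> C j x = 0"
  then have "x = (\<Sum>j\<in>I. C j x *\<^sub>R e j)"
    by (intro coord_eqI) (simp add: coord_basis_sum)
  also have "\<dots> \<in> span (e ` I)" by (intro span_sum span_scale span_base) auto
  finally show "x \<in> span (e ` I)" .
qed

lemma inj_basis: "inj e"
  by (rule injI) (metis coord_basis zero_neq_one)

lemma independent_basis: "independent (e ` I)"
proof (rule independent_if_scalars_zero)
  fix f x assume 0: "(\<Sum>y\<in>e ` I. f y *\<^sub>R y) = 0" and "x \<in> e ` I"
  then obtain i where i: "i \<in> I" "x = e i" by blast
  have "(\<Sum>k\<in>I. f (e k) *\<^sub>R e k) = 0"
    using 0 by (subst (asm) sum.reindex) (auto intro: inj_on_subset[OF inj_basis])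
  then have "C i (\<Sum>k\<in>I. f (e k) *\<^sub>R e k) = 0" by simp
  then show "f x = 0" using i by (simp only: coord_basis_sum) simp
qed simp

lemma dim_span_basis: "dim (span (e ` I)) = card I"
  by (simp add: dim_eq_card_independent[OF independent_basis] card_image inj_on_subset[OF inj_basis])

lemma span_basis_invariant: "(*v) F ` span (e ` I) \<subseteq> span (e ` I)"
  by (auto simp: mem_span_basis coord_apply)

text \<open>The level of the zero vector is the junk value \<open>Max {}\<close>.\<close>

definition level :: "real^'n \<Rightarrow> real" where
  "level x = Max {\<bar>lam j\<bar> | j. C j x \<noteq> 0}"

text \<open>The part of \<open>x\<close> in the eigenspace of \<open>F ** F\<close> for the dominant
  modulus. It has at most two nonzero coordinates, and it is the limit of the normalised iterates of
  \<open>x\<close>.\<close>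

definition lead :: "real^'n \<Rightarrow> real^'n" where
  "lead x = (\<Sum>j | \<bar>lam j\<bar> = level x. C j x *\<^sub>R e j)"

lemma coord_lead: "C j (lead x) = (if \<bar>lam j\<bar> = level x then C j x else 0)"
  unfolding lead_def coord_basis_sum by simp

lemma level_ge: "C j x \<noteq> 0 \<Longrightarrow> \<bar>lam j\<bar> \<le> level x"
  unfolding level_def by (intro Max_ge) auto

lemma level_attained:
  assumes "x \<noteq> 0"
  obtains j where "C j x \<noteq> 0" "\<bar>lam j\<bar> = level x"
proof -
  have "\<exists>j. C j x \<noteq> 0" using assms coord_eqI[of x 0] by auto
  then have "level x \<in> {\<bar>lam j\<bar> | j. C j x \<noteq> 0}"
    unfolding level_def by (intro Max_in) auto
  then show thesis using that by auto
qed

lemma level_pos: "x \<noteq> 0 \<Longrightarrow> 0 < level x"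
  by (metis level_attained lam_nonzero zero_less_abs_iff)

text \<open>Even powers are taken because opposite eigenvalues have the same square; the normalised
  iterates then converge instead of oscillating.\<close>

lemma coord_square_power:
  "C j (((**) (F ** F) ^^ p) (mat 1) *v x) = (lam j)\<^sup>2 ^ p * C j x"
  by (induction p)
    (simp_all add: matrix_vector_mul_assoc[symmetric] coord_apply power2_eq_square)

lemma square_power_tendsto_lead:
  assumes x: "x \<noteq> 0"
  shows "(\<lambda>p. (1 / (level x)\<^sup>2 ^ p) *\<^sub>R (((**) (F ** F) ^^ p) (mat 1) *v x)) \<longlonglongrightarrow> lead x"
proof -
  have pos: "0 < level x" using level_pos[OF x] .
  have coef: "(\<lambda>p. ((lam j)\<^sup>2 / (level x)\<^sup>2) ^ p * C j x) \<longlonglongrightarrow> C j (lead x)" for j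
  proof (cases "C j x = 0")
    case False
    then have le: "\<bar>lam j\<bar> \<le> level x" by (rule level_ge)
    show ?thesis
    proof (cases "\<bar>lam j\<bar> = level x")
      case True
      then have "(lam j)\<^sup>2 = (level x)\<^sup>2" by (metis power2_abs)
      then show ?thesis using pos True by (simp add: coord_lead)
    next
      case False
      then have "\<bar>lam j\<bar>\<^sup>2 < (level x)\<^sup>2" using le by (intro power_strict_mono) auto
      then have "(lam j)\<^sup>2 / (level x)\<^sup>2 < 1" using pos by simp
      then have "(\<lambda>p. ((lam j)\<^sup>2 / (level x)\<^sup>2) ^ p * C j x) \<longlonglongrightarrow> 0 * C j x"
        by (intro tendsto_mult tendsto_const LIMSEQ_realpow_zero) auto
      then show ?thesis using False by (simp add: coord_lead)
    qed
  qed (simp add: coord_lead)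
  have "(1 / (level x)\<^sup>2 ^ p) *\<^sub>R (((**) (F ** F) ^^ p) (mat 1) *v x) =
      (\<Sum>j\<in>UNIV. (((lam j)\<^sup>2 / (level x)\<^sup>2) ^ p * C j x) *\<^sub>R e j)" for p
    by (rule coord_eqI) (simp add: coord_square_power coord_basis_sum power_divide)
  moreover have "(\<lambda>p. \<Sum>j\<in>UNIV. (((lam j)\<^sup>2 / (level x)\<^sup>2) ^ p * C j x) *\<^sub>R e j)
      \<longlonglongrightarrow> (\<Sum>j\<in>UNIV. C j (lead x) *\<^sub>R e j)"
    by (intro tendsto_sum tendsto_scaleR tendsto_const coef)
  ultimately show ?thesis by (simp flip: expand[of "lead x"])
qed

text \<open>Gaussian elimination: the last vector is modified by the span of the others so that its
  level becomes minimal; its leading part is then independent of the others.\<close>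

lemma basis_with_independent_leads:
  assumes "lin_indep n v"
  shows "\<exists>u. (\<forall>k\<le>n. span (u ` {..<k}) = span (v ` {..<k})) \<and> lin_indep n (\<lambda>i. lead (u i))"
  using assms
proof (induction n)
  case 0
  then show ?case by (auto simp: lin_indep_def)
next
  case (Suc n)
  have vn: "v n \<notin> span (v ` {..<n})"
  proof
    assume "v n \<in> span (v ` {..<n})"
    then have "dim (v ` {..<Suc n}) = dim (v ` {..<n})"
      by (simp add: lessThan_Suc dim_insert)
    moreover have "dim (v ` {..<n}) \<le> n"
      using dim_le_card[of "v ` {..<n}" "v ` {..<n}"] card_image_le[of "{..<n}" v]
      by (simp add: span_superset)
    ultimately show False using Suc.prems by (simp add: lin_indep_iff_dim)
  qed
  have "lin_indep n v" using Suc.prems by (rule lin_indep_SucD)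
  then obtain u where u: "\<And>k. k \<le> n \<Longrightarrow> span (u ` {..<k}) = span (v ` {..<k})"
    and leads: "lin_indep n (\<lambda>i. lead (u i))"
    using Suc.IH by blast
  \<comment> \<open>The candidates for replacing \<open>v n\<close> without changing the last span.
    None of them is 0, so their levels are moduli of eigenvalues and a minimum is attained.\<close>
  define X where "X = {v n + y | y. y \<in> span (v ` {..<n})}"
  have X_nz: "x \<noteq> 0" if "x \<in> X" for x
    using that vn span_neg[of "- v n" "v ` {..<n}"] by (auto simp: X_def add_eq_0_iff)
  have "level ` X \<subseteq> range (\<lambda>j. \<bar>lam j\<bar>)"
    using level_attained[OF X_nz] by (metis image_subsetI rangeI)
  then have finX: "finite (level ` X)" by (rule finite_subset) simp
  have "X \<noteq> {}" using span_zero[of "v ` {..<n}"] by (auto simp: X_def)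
  then have "Min (level ` X) \<in> level ` X" using finX by (intro Min_in) auto
  then obtain x where x: "x \<in> X" "level x = Min (level ` X)" by auto
  have x_min: "level x \<le> level y" if "y \<in> X" for y
    using that x(2) finX by simp
  define u' where "u' = u(n := x)"
  have u': "u' ` {..<k} = u ` {..<k}" if "k \<le> n" for k
    using that by (auto simp: u'_def image_iff)
  obtain y0 where y0: "y0 \<in> span (v ` {..<n})" "x = v n + y0" using x(1) by (auto simp: X_def)
  have "span (u' ` {..<Suc n}) = span (v ` {..<Suc n})"
  proof -
    have "span (insert x (u ` {..<n})) = span (insert x (v ` {..<n}))"
      using u[of n] by (simp add: span_insert)
    also have "\<dots> = span (insert (v n) (v ` {..<n}))"
    proof (rule eq_span_insert_eq)
      show "x - v n \<in> span (v ` {..<n})" using y0 by simp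
    qed
    also have "insert x (u ` {..<n}) = u' ` {..<Suc n}"
      unfolding lessThan_Suc image_insert u'[OF order_refl] by (simp add: u'_def)
    finally show ?thesis by (simp only: lessThan_Suc image_insert)
  qed
  then have spans: "\<forall>k\<le>Suc n. span (u' ` {..<k}) = span (v ` {..<k})"
    using u u' by (metis le_Suc_eq)
  have "lin_indep (Suc n) (\<lambda>i. lead (u' i))"
    unfolding lin_indep_def
  proof (rule allI, rule impI)
    fix c assume "(\<Sum>i<Suc n. c i *\<^sub>R lead (u' i)) = 0"
    then have sum0: "(\<Sum>i<n. c i *\<^sub>R lead (u i)) + c n *\<^sub>R lead x = 0"
      by (simp add: u'_def)
    have "c n = 0"
    proof (rule ccontr)
      assume cn: "c n \<noteq> 0"
      define d where "d i = - c i / c n" for i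
      have "c n *\<^sub>R lead x = (\<Sum>i<n. (- c i) *\<^sub>R lead (u i))"
        using sum0 by (simp add: add_eq_0_iff2 sum_negf)
      then have "(1 / c n) *\<^sub>R (c n *\<^sub>R lead x) = (\<Sum>i<n. d i *\<^sub>R lead (u i))"
        by (simp add: scaleR_sum_right d_def)
      then have lead_x: "lead x = (\<Sum>i<n. d i *\<^sub>R lead (u i))" using cn by simp
      \<comment> \<open>At coordinates of modulus \<open>level x\<close> only the \<open>u i\<close>
        of the same level contribute to the relation for \<open>lead x\<close>. Subtracting exactly
        these terms from \<open>x\<close> removes its leading part and adds nothing at higher
        moduli, so \<open>y\<close> contradicts the minimality of \<open>level x\<close>.\<close>
      let ?A = "{i. i < n \<and> level (u i) = level x}"
      define y where "y = x - (\<Sum>i\<in>?A. d i *\<^sub>R u i)"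
      have "(\<Sum>i\<in>?A. d i *\<^sub>R u i) \<in> span (u ` {..<n})"
        by (intro span_sum span_scale span_base) auto
      then have "y0 - (\<Sum>i\<in>?A. d i *\<^sub>R u i) \<in> span (v ` {..<n})"
        using u[of n] y0(1) by (simp add: span_diff)
      moreover have "y = v n + (y0 - (\<Sum>i\<in>?A. d i *\<^sub>R u i))" by (simp add: y_def y0(2))
      ultimately have yX: "y \<in> X" unfolding X_def by blast
      have coord_y: "C j y = C j x - (\<Sum>i\<in>?A. d i * C j (u i))" for j
        by (simp add: y_def coord_sum)
      obtain j where j: "C j y \<noteq> 0" "\<bar>lam j\<bar> = level y" using level_attained[OF X_nz[OF yX]] .
      have ge: "level x \<le> \<bar>lam j\<bar>" using x_min[OF yX] j(2) by simp
      have "C j y = 0"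
      proof (cases "\<bar>lam j\<bar> = level x")
        case True
        have "C j x = C j (lead x)" using True by (simp add: coord_lead)
        also have "\<dots> = (\<Sum>i<n. d i * C j (lead (u i)))" by (simp add: lead_x coord_sum)
        also have "\<dots> = (\<Sum>i\<in>?A. d i * C j (u i))"
          by (rule sum.mono_neutral_cong_right) (use True in \<open>auto simp: coord_lead\<close>)
        finally show ?thesis by (simp add: coord_y)
      next
        case False
        then have "C j z = 0" if "level z = level x" for z
          using level_ge[of j z] ge that by force
        then show ?thesis by (auto simp: coord_y intro!: sum.neutral)
      qed
      with j(1) show False by simp
    qed
    moreover from this have "\<forall>i<n. c i = 0"
      using sum0 leads by (auto simp: lin_indep_def)
    ultimately show "\<forall>i<Suc n. c i = 0" by (auto simp: less_Suc_eq)
  qed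
  with spans show ?case by blast
qed

section \<open>The shape of limit spaces\<close>

text \<open>Each generator lies in one eigenspace of \<open>F ** F\<close>; these are the subspaces
  invariant under \<open>F ** F\<close>.\<close>

definition homogeneous :: "(real^'n) set \<Rightarrow> bool" where
  "homogeneous L \<longleftrightarrow> (\<exists>B. L = span B \<and> (\<forall>b\<in>B. \<exists>\<alpha>. \<forall>j. C j b \<noteq> 0 \<longrightarrow> \<bar>lam j\<bar> = \<alpha>))"

lemma homogeneous_span_leads: "homogeneous (span ((\<lambda>i. lead (u i)) ` A))"
  unfolding homogeneous_def
  by (rule exI[of _ "(\<lambda>i. lead (u i)) ` A"]) (auto simp: coord_lead)

text \<open>Let \<open>I\<close> collect the basis vectors contained in \<open>L\<close>. A
  generator outside their span has at least two nonzero coordinates of one modulus, hence exactly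
  those of the unique pair \<open>p\<close>, \<open>q\<close>. Two such generators are proportional,
  since otherwise a combination of them would put \<open>e q\<close> into \<open>L\<close>.\<close>

lemma homogeneous_cases:
  assumes "homogeneous L"
  obtains I where "L = span (e ` I)"
  | I p q l where "L = span (insert l (e ` I))" "p \<notin> I" "q \<notin> I" "p \<noteq> q" "lam q = - lam p"
      "\<And>j. C j l \<noteq> 0 \<longleftrightarrow> j = p \<or> j = q"
proof -
  obtain B where B: "L = span B" "\<And>b. b \<in> B \<Longrightarrow> \<exists>\<alpha>. \<forall>j. C j b \<noteq> 0 \<longrightarrow> \<bar>lam j\<bar> = \<alpha>"
    using assms by (auto simp: homogeneous_def)
  define I where "I = {j. e j \<in> L}"
  have sub: "subspace L" by (simp add: B(1))
  have eI: "span (e ` I) \<subseteq> L" using sub by (intro span_minimal) (auto simp: I_def)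
  show thesis
  proof (cases "B \<subseteq> span (e ` I)")
    case True
    then have "L = span (e ` I)" using eI span_minimal[of B "span (e ` I)"] by (auto simp: B(1))
    then show thesis by (rule that(1))
  next
    case False
    then obtain l where l: "l \<in> B" "l \<notin> span (e ` I)" by blast
    then obtain p where p: "p \<notin> I" "C p l \<noteq> 0" by (auto simp: mem_span_basis)
    obtain \<alpha> where \<alpha>: "\<And>j. C j l \<noteq> 0 \<Longrightarrow> \<bar>lam j\<bar> = \<alpha>" using B(2)[OF l(1)] by blast
    have lL: "l \<in> L" using l(1) by (simp add: B(1) span_base)
    have mem_basis: "e j \<in> L" if "z \<in> L" "C j z \<noteq> 0" "\<And>k. k \<noteq> j \<Longrightarrow> C k z = 0" for z j
    proof -
      have "e j = (1 / C j z) *\<^sub>R z" using that(2,3) by (intro coord_eqI) (auto simp: coord_basis)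
      then show ?thesis using sub that(1) by (simp add: subspace_scale)
    qed
    obtain q where q: "q \<noteq> p" "C q l \<noteq> 0" using mem_basis[OF lL p(2)] p(1) by (auto simp: I_def)
    have pq: "\<bar>lam p\<bar> = \<bar>lam q\<bar>" using \<alpha>[OF p(2)] \<alpha>[OF q(2)] by simp
    then have lam_q: "lam q = - lam p" using q(1) inj_lam by (metis abs_eq_iff injD)
    have level_pq: "j = p \<or> j = q" if "\<bar>lam j\<bar> = \<bar>lam p\<bar>" for j
      using abs_lam_pair[of j p p q] that pq q(1) by (metis doubleton_eq_iff)
    have supp: "C j l \<noteq> 0 \<longleftrightarrow> j = p \<or> j = q" for j
      using \<alpha>[of j] \<alpha>[OF p(2)] level_pq[of j] p(2) q(2) by auto
    have qI: "q \<notin> I"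
    proof
      assume "q \<in> I"
      then have "l - C q l *\<^sub>R e q \<in> L" using sub lL by (simp add: I_def subspace_diff subspace_scale)
      moreover have "C p (l - C q l *\<^sub>R e q) \<noteq> 0" using p(2) q(1) by (simp add: coord_basis)
      moreover have "C k (l - C q l *\<^sub>R e q) = 0" if "k \<noteq> p" for k
        using that supp[of k] by (cases "k = q") (simp_all add: coord_basis)
      ultimately have "e p \<in> L" by (rule mem_basis)
      then show False using p(1) by (simp add: I_def)
    qed
    have "b \<in> span (insert l (e ` I))" if b: "b \<in> B" for b
    proof (cases "b \<in> span (e ` I)")
      case True
      then show ?thesis using span_mono[of "e ` I" "insert l (e ` I)"] by auto
    next
      case False
      then obtain r where r: "r \<notin> I" "C r b \<noteq> 0" by (auto simp: mem_span_basis)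
      obtain \<beta> where \<beta>: "\<And>j. C j b \<noteq> 0 \<Longrightarrow> \<bar>lam j\<bar> = \<beta>" using B(2)[OF b] by blast
      have bL: "b \<in> L" using b by (simp add: B(1) span_base)
      obtain s where s: "s \<noteq> r" "C s b \<noteq> 0" using mem_basis[OF bL r(2)] r(1) by (auto simp: I_def)
      have "{r, s} = {p, q}"
        using abs_lam_pair[of r s p q] \<beta>[OF r(2)] \<beta>[OF s(2)] s(1) q(1) pq by auto
      then have "\<bar>lam p\<bar> = \<beta>" using \<beta>[OF r(2)] pq by (auto simp: doubleton_eq_iff)
      then have supp_b: "C j b = 0" if "j \<noteq> p" "j \<noteq> q" for j
        using that \<beta>[of j] level_pq[of j] by auto
      \<comment> \<open>Cancelling the coordinate at \<open>p\<close> leaves at most the one at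
        \<open>q\<close>; were it nonzero, \<open>e q\<close> would lie in \<open>L\<close>.\<close>
      define z where "z = b - (C p b / C p l) *\<^sub>R l"
      have zL: "z \<in> L" using sub bL lL by (simp add: z_def subspace_diff subspace_scale)
      have z0: "C j z = 0" if "j \<noteq> q" for j
        using that supp_b[of j] supp[of j] p(2) by (cases "j = p") (auto simp: z_def)
      have "C q z = 0" using mem_basis[OF zL _ z0] qI by (auto simp: I_def)
      then have "z = 0" using z0 by (intro coord_eqI) (metis coord_simps(1))
      then have "b = (C p b / C p l) *\<^sub>R l" by (simp add: z_def)
      then show ?thesis by (metis insertI1 span_base span_scale)
    qed
    then have "L \<subseteq> span (insert l (e ` I))" unfolding B(1) by (intro span_minimal) auto
    moreover have "span (insert l (e ` I)) \<subseteq> L"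
      using sub lL by (intro span_minimal) (auto simp: I_def)
    ultimately show thesis using that(2)[OF _ p(1) qI q(1)[symmetric] lam_q supp] by blast
  qed
qed

text \<open>If \<open>L\<close> contains a line of the plane of \<open>e p\<close> and
  \<open>e q\<close>, then \<open>insert p I\<close> serves as index set. The map \<open>F\<close>
  reflects that line, up to scaling, because the eigenvalues are opposite; if both \<open>L\<close>
  and its image met \<open>P\<close>, a combination of the two intersection vectors would lie in the
  coordinate space.\<close>

lemma homogeneous_transversal:
  assumes "homogeneous L"
  shows "\<exists>I. card I = dim L \<and> (\<forall>P. subspace P \<longrightarrow> transversal (span (e ` I)) P \<longrightarrow>
    transversal L P \<or> transversal ((*v) F ` L) P)"
  using assms
proof (cases rule: homogeneous_cases)
  case (1 I)
  then show ?thesis using dim_span_basis[of I] by (intro exI[of _ I]) simp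
next
  case (2 I p q l)
  have "l \<notin> span (e ` I)" using 2(2) 2(6)[of p] by (auto simp: mem_span_basis)
  then have "dim L = Suc (card I)"
    using dim_insert[of l "e ` I"] dim_span_basis[of I] 2(1) by simp
  moreover have "card (insert p I) = Suc (card I)" using 2(2) by simp
  moreover have "transversal L P \<or> transversal ((*v) F ` L) P"
    if P: "subspace P" and tr: "transversal (span (e ` insert p I)) P" for P
  proof (rule ccontr)
    assume "\<not> ?thesis"
    then obtain x y where x: "x \<in> L" "x \<in> P" "x \<noteq> 0" and y: "y \<in> L" "F *v y \<in> P" "F *v y \<noteq> 0"
      by blast
    obtain s where s: "x - s *\<^sub>R l \<in> span (e ` I)" using x(1) 2(1) by (auto simp: span_insert)
    obtain t where t: "y - t *\<^sub>R l \<in> span (e ` I)" using y(1) 2(1) by (auto simp: span_insert)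
    have cx: "C j x = s * C j l" if "j \<notin> I" for j using s that by (simp add: mem_span_basis)
    have cy: "C j y = t * C j l" if "j \<notin> I" for j using t that by (simp add: mem_span_basis)
    \<comment> \<open>The coefficients make the coordinate at \<open>q\<close> proportional to
      \<open>lam p + lam q = 0\<close>, so \<open>z\<close> lies in the coordinate space and in
      \<open>P\<close>. Hence \<open>z = 0\<close>, and its coordinate at \<open>p\<close> forces
      \<open>s = 0\<close> or \<open>t = 0\<close>.\<close>
    define z where "z = (t * lam p) *\<^sub>R x + s *\<^sub>R (F *v y)"
    have zP: "z \<in> P" unfolding z_def using P x(2) y(2) by (intro subspace_add subspace_scale)
    have cz: "C j z = (lam p + lam j) * (s * t) * C j l" if "j \<notin> I" for j
      using cx[OF that] cy[OF that] by (simp add: z_def coord_apply algebra_simps)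
    have "z \<in> span (e ` insert p I)"
      unfolding mem_span_basis
    proof (intro allI impI)
      fix j assume "j \<notin> insert p I"
      then show "C j z = 0" using cz[of j] 2(5) 2(6)[of j] by (cases "j = q") auto
    qed
    then have "z = 0" using zP tr by blast
    then have "(lam p + lam p) * (s * t) * C p l = 0" using cz[OF 2(2)] by simp
    then have "s = 0 \<or> t = 0" using lam_nonzero[of p] 2(6)[of p] by auto
    then show False
    proof
      assume "s = 0"
      then have "x \<in> span (e ` insert p I)" using cx by (simp add: mem_span_basis del: image_insert)
      then show False using x tr by blast
    next
      assume "t = 0"
      then have "F *v y \<in> span (e ` insert p I)" using cy by (simp add: mem_span_basis coord_apply del: image_insert)
      then show False using y tr by blast
    qed
  qed
  ultimately show ?thesis by (intro exI[of _ "insert p I"]) simp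
qed

end

section \<open>Flags of two consecutive dimensions and their limits\<close>

definition is_flag :: "nat \<Rightarrow> 'a::euclidean_space set \<Rightarrow> 'a set \<Rightarrow> bool" where
  "is_flag a V V' \<longleftrightarrow> subspace V \<and> subspace V' \<and> V \<subseteq> V' \<and> dim V = a \<and> dim V' = Suc a"

text \<open>A substitute for membership in the closure of an orbit of flags: transversality to the second
  flag can be transported to the orbit of the first one.\<close>

definition reaches :: "(real^'n^'n) set \<Rightarrow> (real^'n) set \<Rightarrow> (real^'n) set \<Rightarrow> (real^'n) set \<Rightarrow> (real^'n) set \<Rightarrow> bool" where
  "reaches Q V V' L L' \<longleftrightarrow> (\<forall>U U'. subspace U \<longrightarrow> subspace U' \<longrightarrow> transversal L U \<longrightarrow> transversal L' U' \<longrightarrow>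
    (\<exists>S\<in>Q. transversal ((*v) S ` V) U \<and> transversal ((*v) S ` V') U'))"

lemma reachesE:
  assumes "reaches Q V V' L L'" "subspace U" "subspace U'" "transversal L U" "transversal L' U'"
  obtains S where "S \<in> Q" "transversal ((*v) S ` V) U" "transversal ((*v) S ` V') U'"
  using assms unfolding reaches_def by metis

lemma image_matrix_mult: "(*v) (S ** T) ` X = (*v) S ` ((*v) T ` X)"
  by (simp add: image_image matrix_vector_mul_assoc)

lemma image_mat_1 [simp]: "(*v) (mat 1) ` X = X"
  by simp

lemma invertible_mat_1 [simp]: "invertible (mat 1)"
  unfolding invertible_def by (rule exI[of _ "mat 1"]) simp

lemma subspace_matrix_image: "subspace X \<Longrightarrow> subspace ((*v) S ` X)" for S :: "real^'n^'m"
  by (intro linear_subspace_image matrix_vector_mul_linear)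

lemma matrix_inv_mult:
  assumes "invertible S"
  shows "S ** matrix_inv S = mat 1" "matrix_inv S ** S = mat 1"
  using someI_ex[OF assms[unfolded invertible_def]] by (simp_all add: matrix_inv_def)

lemma matrix_inv_apply:
  assumes "invertible (S :: real^'n^'n)"
  shows "matrix_inv S *v (S *v x) = x" "S *v (matrix_inv S *v x) = x"
  using matrix_inv_mult[OF assms]
  by (simp_all add: matrix_vector_mul_assoc)

text \<open>Moves a word from the first space to the second, where it acts by its inverse.\<close>

lemma transversal_image_iff:
  assumes S: "invertible (S :: real^'n^'n)"
  shows "transversal ((*v) S ` X) Y \<longleftrightarrow> transversal X ((*v) (matrix_inv S) ` Y)"
proof -
  have eq0: "S *v x = 0 \<longleftrightarrow> x = 0" for x
    using matrix_inv_apply(1)[OF S, of x] by auto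
  have mem: "x \<in> (*v) (matrix_inv S) ` Y \<longleftrightarrow> S *v x \<in> Y" for x
  proof
    assume "x \<in> (*v) (matrix_inv S) ` Y"
    then show "S *v x \<in> Y" using matrix_inv_apply(2)[OF S] by auto
  next
    assume "S *v x \<in> Y"
    then show "x \<in> (*v) (matrix_inv S) ` Y"
      using matrix_inv_apply(1)[OF S, of x] by (intro image_eqI[of _ _ "S *v x"]) simp_all
  qed
  have "transversal ((*v) S ` X) Y \<longleftrightarrow> (\<forall>x\<in>X. S *v x \<in> Y \<longrightarrow> S *v x = 0)" by auto
  also have "\<dots> \<longleftrightarrow> (\<forall>x\<in>X. x \<in> (*v) (matrix_inv S) ` Y \<longrightarrow> x = 0)" unfolding eq0 mem ..
  also have "\<dots> \<longleftrightarrow> transversal X ((*v) (matrix_inv S) ` Y)" by auto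
  finally show ?thesis .
qed

lemma dim_matrix_image:
  assumes S: "invertible (S :: real^'n^'n)"
  shows "dim ((*v) S ` X) = dim X"
proof (rule dim_image_eq[OF matrix_vector_mul_linear])
  show "inj_on ((*v) S) (span X)"
    using matrix_inv_apply(1)[OF S] by (intro inj_on_inverseI)
qed

lemma is_flag_image:
  assumes "invertible (S :: real^'n^'n)" "is_flag a V V'"
  shows "is_flag a ((*v) S ` V) ((*v) S ` V')"
  using assms by (auto simp: is_flag_def subspace_matrix_image dim_matrix_image)

lemma is_flag_basis:
  fixes V :: "'a::euclidean_space set"
  assumes "is_flag a V V'"
  obtains v where "lin_indep (Suc a) v" "V = span (v ` {..<a})" "V' = span (v ` {..<Suc a})"
proof -
  have fl: "subspace V" "subspace V'" "V \<subseteq> V'" "dim V = a" "dim V' = Suc a"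
    using assms by (auto simp: is_flag_def)
  obtain B where B: "B \<subseteq> V" "independent B" "V \<subseteq> span B" "card B = a"
    using basis_exists[of V] fl(4) by metis
  have spanB: "span B = V" using B fl(1) by (simp add: span_minimal subset_antisym)
  obtain h where h: "bij_betw h {0..<card B} B"
    using ex_bij_betw_nat_finite finiteI_independent[OF B(2)] by blast
  have "V \<noteq> V'" using fl by auto
  then obtain x where x: "x \<in> V'" "x \<notin> V" using fl(3) by blast
  define v where "v = h(a := x)"
  have "v ` {..<a} = h ` {..<a}" by (auto simp: v_def)
  then have va: "v ` {..<a} = B" using h B(4) by (simp add: bij_betw_def lessThan_atLeast0)
  have vSa: "v ` {..<Suc a} = insert x B"
    unfolding lessThan_Suc image_insert va by (simp add: v_def)
  have dimS: "dim (insert x B) = Suc a"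
    using x(2) spanB B by (simp add: dim_insert dim_eq_card_independent)
  moreover have "span (insert x B) \<subseteq> V'"
    using x(1) B(1) fl by (intro span_minimal) auto
  ultimately have "span (insert x B) = V'"
    using fl by (intro subspace_dim_equal) auto
  with dimS vSa va spanB show thesis
    by (intro that[of v]) (simp_all add: lin_indep_iff_dim)
qed

context eigenbasis
begin

text \<open>The limit flag is spanned by the leading parts of an adapted basis, which are limits of
  rescaled vectors \<open>M p *v u i\<close>; openness of transversality gives
  \<open>reaches\<close>. If a member avoids the coordinate space of moduli below
  \<open>\<tau>\<close>, all its adapted basis vectors have level at least \<open>\<tau>\<close>, so
  the limit lies in the complementary coordinate space.\<close>

lemma flag_limit:
  assumes fl: "is_flag a V V'"
    and Q: "mat 1 \<in> Q" "\<And>S T. S \<in> Q \<Longrightarrow> T \<in> Q \<Longrightarrow> S ** T \<in> Q" "F \<in> Q"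
  obtains L L' where "is_flag a L L'" "homogeneous L" "homogeneous L'" "reaches Q V V' L L'"
    "\<And>\<tau>. transversal V (span (e ` {j. \<bar>lam j\<bar> < \<tau>})) \<Longrightarrow> L \<subseteq> span (e ` {j. \<tau> \<le> \<bar>lam j\<bar>})"
    "\<And>\<tau>. transversal V' (span (e ` {j. \<bar>lam j\<bar> < \<tau>})) \<Longrightarrow> L' \<subseteq> span (e ` {j. \<tau> \<le> \<bar>lam j\<bar>})"
proof -
  obtain v where v: "lin_indep (Suc a) v" and V: "V = span (v ` {..<a})" "V' = span (v ` {..<Suc a})"
    using is_flag_basis[OF fl] .
  obtain u where u: "\<And>k. k \<le> Suc a \<Longrightarrow> span (u ` {..<k}) = span (v ` {..<k})"
    and leads: "lin_indep (Suc a) (\<lambda>i. lead (u i))"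
    using basis_with_independent_leads[OF v] by blast
  define l where "l i = lead (u i)" for i
  have l: "lin_indep a l" "lin_indep (Suc a) l"
    using leads lin_indep_SucD[OF leads] unfolding l_def by simp_all
  have l_nz: "u i \<noteq> 0" if "i < Suc a" for i
  proof
    assume "u i = 0"
    then have "l i = 0" unfolding l_def by (intro coord_eqI) (simp add: coord_lead)
    then have "(\<Sum>k<Suc a. (if k = i then 1 else 0) *\<^sub>R lead (u k)) = 0"
      by (intro sum.neutral) (auto simp: l_def)
    then have "(if i = i then 1 else 0) = (0 :: real)"
      using that by (intro leads[unfolded lin_indep_def, rule_format]) simp_all
    then show False by simp
  qed
  define M where "M p = ((**) (F ** F) ^^ p) (mat 1)" for p
  have MQ: "M p \<in> Q" for p
    unfolding M_def by (induction p) (simp_all add: Q)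
  define y where "y p i = (1 / (level (u i))\<^sup>2 ^ p) *\<^sub>R (M p *v u i)" for p i
  have lim: "(\<lambda>p. y p i) \<longlonglongrightarrow> l i" if "i < Suc a" for i
    unfolding y_def M_def l_def using l_nz[OF that] by (rule square_power_tendsto_lead)
  have image_M: "(*v) (M p) ` span (u ` {..<n}) \<subseteq> span (y p ` {..<n})" if n: "n \<le> Suc a" for n p
  proof
    fix z assume "z \<in> (*v) (M p) ` span (u ` {..<n})"
    then obtain c where "z = M p *v (\<Sum>i<n. c i *\<^sub>R u i)" by (auto simp: span_image_lessThan)
    also have "\<dots> = (\<Sum>i<n. c i *\<^sub>R (M p *v u i))"
      by (simp add: linear_sum[OF matrix_vector_mul_linear] matrix_vector_mult_scaleR)
    also have "\<dots> = (\<Sum>i<n. (c i * (level (u i))\<^sup>2 ^ p) *\<^sub>R y p i)"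
    proof (rule sum.cong[OF refl])
      fix i assume "i \<in> {..<n}"
      then have "level (u i) \<noteq> 0" using n level_pos[OF l_nz[of i]] by auto
      then show "c i *\<^sub>R (M p *v u i) = (c i * (level (u i))\<^sup>2 ^ p) *\<^sub>R y p i" by (simp add: y_def)
    qed
    finally show "z \<in> span (y p ` {..<n})" by (auto simp: span_image_lessThan)
  qed
  let ?L = "span (l ` {..<a})" and ?L' = "span (l ` {..<Suc a})"
  have "reaches Q V V' ?L ?L'"
    unfolding reaches_def
  proof (intro allI impI)
    fix U U' :: "(real^'n) set"
    assume U: "subspace U" "subspace U'" "transversal ?L U" "transversal ?L' U'"
    \<comment> \<open>Both conditions hold for all large \<open>p\<close>, so a single power serves
      both members of the flag.\<close>
    have "\<forall>\<^sub>F p in sequentially. transversal (span (y p ` {..<a})) U"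
      using U l lim by (intro eventually_transversal[of U a l]) auto
    moreover have "\<forall>\<^sub>F p in sequentially. transversal (span (y p ` {..<Suc a})) U'"
      using U l lim by (intro eventually_transversal[of U' "Suc a" l]) auto
    ultimately have "\<forall>\<^sub>F p in sequentially. transversal (span (y p ` {..<a})) U \<and>
        transversal (span (y p ` {..<Suc a})) U'"
      by (rule eventually_conj)
    then obtain p where p: "transversal (span (y p ` {..<a})) U" "transversal (span (y p ` {..<Suc a})) U'"
      using eventually_happens'[OF sequentially_bot] by blast
    have "transversal ((*v) (M p) ` V) U" using p(1) image_M[of a p] u[of a] V(1) by fastforce
    moreover have "transversal ((*v) (M p) ` V') U'" using p(2) image_M[of "Suc a" p] u[of "Suc a"] V(2) by fastforce
    ultimately show "\<exists>S\<in>Q. transversal ((*v) S ` V) U \<and> transversal ((*v) S ` V') U'" using MQ by blast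
  qed
  moreover have "is_flag a ?L ?L'"
    using l unfolding is_flag_def lin_indep_iff_dim
    by (auto intro: span_mono[THEN subsetD, rotated])
  moreover have "homogeneous ?L" "homogeneous ?L'"
    unfolding l_def by (rule homogeneous_span_leads)+
  moreover have high: "span (l ` {..<n}) \<subseteq> span (e ` {j. \<tau> \<le> \<bar>lam j\<bar>})"
    if n: "n \<le> Suc a" and tr: "transversal (span (v ` {..<n})) (span (e ` {j. \<bar>lam j\<bar> < \<tau>}))" for n \<tau>
  proof (rule span_minimal)
    show "l ` {..<n} \<subseteq> span (e ` {j. \<tau> \<le> \<bar>lam j\<bar>})"
    proof clarify
      fix i assume i: "i < n"
      have "u i \<in> span (v ` {..<n})" using i u[OF n] by (metis imageI lessThan_iff span_base)
      then have "u i \<notin> span (e ` {j. \<bar>lam j\<bar> < \<tau>})" using tr l_nz[of i] i n by auto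
      then obtain k where "C k (u i) \<noteq> 0" "\<tau> \<le> \<bar>lam k\<bar>" by (auto simp: mem_span_basis not_less)
      then have "\<tau> \<le> level (u i)" using level_ge[of k "u i"] by simp
      then show "l i \<in> span (e ` {j. \<tau> \<le> \<bar>lam j\<bar>})" by (auto simp: l_def mem_span_basis coord_lead)
    qed
  qed simp
  ultimately show thesis
    using that[of ?L ?L'] high[of a] high[of "Suc a"] V by auto
qed

text \<open>Every modulus belongs to one or two eigenvalues. As the threshold decreases, the number
  of eigenvalues above it grows by steps of at most 2, so it cannot skip both \<open>a\<close> and
  \<open>Suc a\<close>.\<close>

lemma exists_level_cut:
  assumes "a \<le> CARD('n)"
  shows "\<exists>\<tau>. card {j. \<tau> \<le> \<bar>lam j\<bar>} = a \<or> card {j. \<tau> \<le> \<bar>lam j\<bar>} = Suc a"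
  using assms
proof (induction a)
  case 0
  have "{j. Max (range (\<lambda>j. \<bar>lam j\<bar>)) + 1 \<le> \<bar>lam j\<bar>} = {}"
  proof safe
    fix j assume "Max (range (\<lambda>j. \<bar>lam j\<bar>)) + 1 \<le> \<bar>lam j\<bar>"
    moreover have "\<bar>lam j\<bar> \<le> Max (range (\<lambda>j. \<bar>lam j\<bar>))" by (intro Max_ge) auto
    ultimately show "j \<in> {}" by linarith
  qed
  then show ?case by (metis card.empty)
next
  case (Suc a)
  then obtain \<tau> where \<tau>: "card {j. \<tau> \<le> \<bar>lam j\<bar>} = a \<or> card {j. \<tau> \<le> \<bar>lam j\<bar>} = Suc a" by auto
  show ?case
  proof (cases "card {j. \<tau> \<le> \<bar>lam j\<bar>} = Suc a")
    case False
    then have a: "card {j. \<tau> \<le> \<bar>lam j\<bar>} = a" using \<tau> by simp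
    let ?X = "(\<lambda>j. \<bar>lam j\<bar>) ` {j. \<bar>lam j\<bar> < \<tau>}"
    have "{j. \<tau> \<le> \<bar>lam j\<bar>} \<noteq> UNIV" using a Suc.prems by auto
    then have "?X \<noteq> {}" by (auto simp: not_le)
    then have "Max ?X \<in> ?X" by (intro Max_in) auto
    then obtain k where k: "\<bar>lam k\<bar> < \<tau>" "Max ?X = \<bar>lam k\<bar>" by auto
    have ge: "\<bar>lam j\<bar> \<le> \<bar>lam k\<bar>" if "\<bar>lam j\<bar> < \<tau>" for j
      using Max_ge[of ?X "\<bar>lam j\<bar>"] that k(2) by auto
    let ?E = "{j. \<bar>lam j\<bar> = \<bar>lam k\<bar>}"
    have "{j. \<bar>lam k\<bar> \<le> \<bar>lam j\<bar>} = {j. \<tau> \<le> \<bar>lam j\<bar>} \<union> ?E"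
    proof (rule Set.set_eqI)
      show "j \<in> {j. \<bar>lam k\<bar> \<le> \<bar>lam j\<bar>} \<longleftrightarrow> j \<in> {j. \<tau> \<le> \<bar>lam j\<bar>} \<union> ?E" for j
        using ge[of j] k(1) by (cases "\<bar>lam j\<bar> < \<tau>") auto
    qed
    then have card: "card {j. \<bar>lam k\<bar> \<le> \<bar>lam j\<bar>} = a + card ?E"
      using a k(1) card_Un_disjoint[of "{j. \<tau> \<le> \<bar>lam j\<bar>}" ?E] by fastforce
    have "card ?E = 1 \<or> card ?E = 2"
    proof (cases "?E = {k}")
      case False
      then obtain i where i: "i \<noteq> k" "\<bar>lam i\<bar> = \<bar>lam k\<bar>" by auto
      have "j = i" if "\<bar>lam j\<bar> = \<bar>lam k\<bar>" "j \<noteq> k" for j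
        using abs_lam_pair[OF that i(2,1)] that(2) by blast
      then have "?E = {i, k}" using i(2) by blast
      then show ?thesis using i(1) by simp
    qed simp
    then show ?thesis using card by (intro exI[of _ "\<bar>lam k\<bar>"]) auto
  qed blast
qed

text \<open>Makes the limit results available for inverse powers, which act on the second flag;
  basis and coordinates stay the same.\<close>

lemma eigenbasis_inverse:
  assumes "invertible F"
  shows "eigenbasis (matrix_inv F) e (\<lambda>i. inverse (lam i)) C"
proof
  show "matrix_inv F *v e i = inverse (lam i) *\<^sub>R e i" for i
  proof -
    have "e i = matrix_inv F *v (lam i *\<^sub>R e i)"
      using matrix_inv_apply(1)[OF assms, of "e i"] by (simp add: eigenvector)
    then have "e i = lam i *\<^sub>R (matrix_inv F *v e i)" by (simp add: matrix_vector_mult_scaleR)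
    then show ?thesis using lam_nonzero[of i]
      by (metis scaleR_scaleR left_inverse scaleR_one)
  qed
  show "inj (\<lambda>i. inverse (lam i))" using inj_lam by (simp add: inj_def)
  show "{i, j} = {k, l}" if "\<bar>inverse (lam i)\<bar> = \<bar>inverse (lam j)\<bar>" "i \<noteq> j"
    "\<bar>inverse (lam k)\<bar> = \<bar>inverse (lam l)\<bar>" "k \<noteq> l" for i j k l
    using abs_lam_pair[of i j k l] that by simp
qed (use linear_coord expand coord_basis lam_nonzero in auto)

end

lemma matrix_inv_unique:
  assumes "A ** B = mat 1" "B ** A = mat 1"
  shows "matrix_inv A = B"
proof -
  have "invertible A" using assms by (auto simp: invertible_def)
  then have "matrix_inv A = matrix_inv A ** (A ** B)" using assms(1) by simp
  also have "\<dots> = B" using matrix_inv_mult(2)[OF \<open>invertible A\<close>] by (simp add: matrix_mul_assoc)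
  finally show ?thesis .
qed

lemma matrix_inv_mat_1: "matrix_inv (mat 1) = mat 1"
  by (rule matrix_inv_unique) simp_all

lemma invertible_matrix_inv: "invertible S \<Longrightarrow> invertible (matrix_inv S)"
  using matrix_inv_mult unfolding invertible_def by blast

lemma matrix_inv_inv: "invertible S \<Longrightarrow> matrix_inv (matrix_inv S) = S"
  using matrix_inv_mult by (intro matrix_inv_unique)

lemma matrix_inv_mult_distrib:
  assumes "invertible (S :: real^'n^'n)" "invertible (T :: real^'n^'n)"
  shows "matrix_inv (S ** T) = matrix_inv T ** matrix_inv S"
proof (rule matrix_inv_unique)
  have "S ** T ** (matrix_inv T ** matrix_inv S) = S ** (T ** matrix_inv T) ** matrix_inv S"
    by (simp add: matrix_mul_assoc)
  then show "S ** T ** (matrix_inv T ** matrix_inv S) = mat 1" using assms by (simp add: matrix_inv_mult)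
  have "matrix_inv T ** matrix_inv S ** (S ** T) = matrix_inv T ** (matrix_inv S ** S) ** T"
    by (simp add: matrix_mul_assoc)
  then show "matrix_inv T ** matrix_inv S ** (S ** T) = mat 1" using assms by (simp add: matrix_inv_mult)
qed

section \<open>Two eigenbases in general position\<close>

text \<open>The word \<open>S\<close> for the second stage is chosen first and moved to the target
  by its inverse; \<open>T\<close> is then chosen for the moved target, and \<open>S ** T\<close>
  does both.\<close>

lemma reaches_trans:
  assumes "reaches Q V V' L L'" "reaches Q L L' M M'"
    and mult: "\<And>S T. S \<in> Q \<Longrightarrow> T \<in> Q \<Longrightarrow> S ** T \<in> Q" and inv: "\<And>S. S \<in> Q \<Longrightarrow> invertible S"
  shows "reaches Q V V' M M'"
  unfolding reaches_def
proof (intro allI impI)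
  fix U U' assume U: "subspace U" "subspace U'" "transversal M U" "transversal M' U'"
  obtain S where S: "S \<in> Q" "transversal ((*v) S ` L) U" "transversal ((*v) S ` L') U'"
    using reachesE[OF assms(2) U] .
  let ?i = "(*v) (matrix_inv S)"
  obtain T where T: "T \<in> Q" "transversal ((*v) T ` V) (?i ` U)" "transversal ((*v) T ` V') (?i ` U')"
    using reachesE[OF assms(1), of "?i ` U" "?i ` U'"] S U subspace_matrix_image
    by (metis inv transversal_image_iff)
  then show "\<exists>S\<in>Q. transversal ((*v) S ` V) U \<and> transversal ((*v) S ` V') U'"
    using S(1) mult inv by (intro bexI[of _ "S ** T"]) (simp_all add: image_matrix_mult transversal_image_iff)
qed

text \<open>The axiom \<open>basis_transversal\<close> is the geometric form of the hypothesis on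
  the minors; it is symmetric in the two bases and unaffected by inverting \<open>F\<close> or
  \<open>G\<close>.\<close>

locale eigenbasis_pair =
  A: eigenbasis F e1 lam C1 + B: eigenbasis G e2 t C2
  for F :: "real^'n^'n" and e1 lam C1 and G :: "real^'n^'n" and e2 t C2 +
  assumes basis_transversal:
      "card I + card K \<le> CARD('n) \<Longrightarrow> transversal (span (e1 ` I)) (span (e2 ` K))"
    and invertible_fst: "invertible F" and invertible_snd: "invertible G"
begin

lemma swap: "eigenbasis_pair G e2 t C2 F e1 lam C1"
proof
  show "transversal (span (e2 ` I)) (span (e1 ` K))" if "card I + card K \<le> CARD('n)" for I K
    using basis_transversal[of K I] that by (simp add: add.commute Int_commute)
qed (rule invertible_fst invertible_snd)+

lemma inverse_snd:
  "eigenbasis_pair F e1 lam C1 (matrix_inv G) e2 (\<lambda>i. inverse (t i)) C2"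
proof -
  interpret B': eigenbasis "matrix_inv G" e2 "\<lambda>i. inverse (t i)" C2
    by (rule B.eigenbasis_inverse[OF invertible_snd])
  show ?thesis
    by unfold_locales
      (use basis_transversal invertible_fst invertible_matrix_inv[OF invertible_snd] in auto)
qed

text \<open>Start from two transversal coordinate spaces of the right dimensions. First
  \<open>R\<close> replaces the one of \<open>e2\<close> by an image of \<open>P\<close>, then
  \<open>S\<close> replaces the one of \<open>e1\<close> by an image of \<open>N\<close>.\<close>

lemma homogeneous_pair_transversal:
  assumes N: "A.homogeneous N" and P: "B.homogeneous P" and dim: "dim N + dim P \<le> CARD('n)"
  obtains S R where "S \<in> {mat 1, F}" "R \<in> {mat 1, G}" "transversal ((*v) S ` N) ((*v) R ` P)"
proof -
  obtain I where I: "card I = dim N" "\<And>X. subspace X \<Longrightarrow> transversal (span (e1 ` I)) X \<Longrightarrow>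
      transversal N X \<or> transversal ((*v) F ` N) X"
    using A.homogeneous_transversal[OF N] by blast
  obtain K where K: "card K = dim P" "\<And>X. subspace X \<Longrightarrow> transversal (span (e2 ` K)) X \<Longrightarrow>
      transversal P X \<or> transversal ((*v) G ` P) X"
    using B.homogeneous_transversal[OF P] by blast
  have "transversal (span (e2 ` K)) (span (e1 ` I))"
    using basis_transversal[of I K] I(1) K(1) dim by (simp add: Int_commute)
  then have "transversal P (span (e1 ` I)) \<or> transversal ((*v) G ` P) (span (e1 ` I))"
    using K(2) subspace_span by blast
  then obtain R where R: "R \<in> {mat 1, G}" "transversal ((*v) R ` P) (span (e1 ` I))"
    by (metis image_mat_1 insertCI)
  have "subspace P" using P by (auto simp: B.homogeneous_def)
  then have "subspace ((*v) R ` P)" by (rule subspace_matrix_image)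
  then have "transversal N ((*v) R ` P) \<or> transversal ((*v) F ` N) ((*v) R ` P)"
    using I(2) R(2) by (metis Int_commute)
  then obtain S where "S \<in> {mat 1, F}" "transversal ((*v) S ` N) ((*v) R ` P)"
    by (metis image_mat_1 insertCI)
  with R(1) show thesis by (intro that)
qed

text \<open>A limit under \<open>F\<close> makes the flag homogeneous; then 1 or \<open>F\<close>
  makes one member transversal to the low coordinate space of \<open>G\<close>. The limit of that
  member under \<open>G\<close> lies in the high coordinate space, and the cut \<open>\<tau>\<close>
  is chosen so that the dimensions agree.\<close>

lemma reaches_flag_with_invariant_part:
  assumes fl: "is_flag a V V'"
    and Q: "mat 1 \<in> Q" "\<And>S T. S \<in> Q \<Longrightarrow> T \<in> Q \<Longrightarrow> S ** T \<in> Q" "F \<in> Q" "G \<in> Q"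
      "\<And>S. S \<in> Q \<Longrightarrow> invertible S"
  obtains M M' where "is_flag a M M'" "B.homogeneous M" "B.homogeneous M'" "reaches Q V V' M M'"
    "(\<exists>K. M = span (e2 ` K)) \<or> (\<exists>K. M' = span (e2 ` K))"
proof -
  obtain L L' where L: "is_flag a L L'" "A.homogeneous L" "A.homogeneous L'" "reaches Q V V' L L'"
    using A.flag_limit[OF fl Q(1,2,3)] by metis
  have "Suc a \<le> CARD('n)" using fl dim_subset_UNIV_cart[of V'] by (simp add: is_flag_def)
  then obtain \<tau> where \<tau>: "card {j. \<tau> \<le> \<bar>t j\<bar>} = a \<or> card {j. \<tau> \<le> \<bar>t j\<bar>} = Suc a"
    using B.exists_level_cut[of a] by auto
  \<comment> \<open>The member of the flag whose dimension is the size of the cut.\<close>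
  define N where "N = (if card {j. \<tau> \<le> \<bar>t j\<bar>} = a then L else L')"
  have N: "A.homogeneous N" "dim N = card {j. \<tau> \<le> \<bar>t j\<bar>}"
    using L \<tau> by (auto simp: N_def is_flag_def)
  let ?K = "{j. \<bar>t j\<bar> < \<tau>}"
  have "card {j. \<tau> \<le> \<bar>t j\<bar>} + card ?K = card ({j. \<tau> \<le> \<bar>t j\<bar>} \<union> ?K)"
    by (rule card_Un_disjoint[symmetric]) auto
  also have "{j. \<tau> \<le> \<bar>t j\<bar>} \<union> ?K = UNIV" by auto
  finally have card: "card {j. \<tau> \<le> \<bar>t j\<bar>} + card ?K = CARD('n)" .
  obtain I where I: "card I = dim N" "\<And>X. subspace X \<Longrightarrow> transversal (span (e1 ` I)) X \<Longrightarrow>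
      transversal N X \<or> transversal ((*v) F ` N) X"
    using A.homogeneous_transversal[OF N(1)] by blast
  have "transversal N (span (e2 ` ?K)) \<or> transversal ((*v) F ` N) (span (e2 ` ?K))"
    using I(1) N(2) card by (intro I(2) basis_transversal subspace_span) simp
  then obtain S where S: "S \<in> {mat 1, F}" "transversal ((*v) S ` N) (span (e2 ` ?K))"
    by (metis image_mat_1 insertCI)
  have SQ: "S \<in> Q" using S(1) Q by auto
  have flS: "is_flag a ((*v) S ` L) ((*v) S ` L')" by (rule is_flag_image[OF Q(5)[OF SQ] L(1)])
  obtain M M' where M: "is_flag a M M'" "B.homogeneous M" "B.homogeneous M'"
    and reach: "reaches Q ((*v) S ` L) ((*v) S ` L') M M'"
    and high: "transversal ((*v) S ` L) (span (e2 ` ?K)) \<Longrightarrow> M \<subseteq> span (e2 ` {j. \<tau> \<le> \<bar>t j\<bar>})"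
      "transversal ((*v) S ` L') (span (e2 ` ?K)) \<Longrightarrow> M' \<subseteq> span (e2 ` {j. \<tau> \<le> \<bar>t j\<bar>})"
    using B.flag_limit[OF flS Q(1,2,4)] by metis
  have "reaches Q L L' ((*v) S ` L) ((*v) S ` L')"
    using SQ by (auto simp: reaches_def)
  then have "reaches Q V V' M M'"
    using L(4) reach Q(2,5) by (blast intro: reaches_trans)
  moreover have "(\<exists>K. M = span (e2 ` K)) \<or> (\<exists>K. M' = span (e2 ` K))"
  proof (cases "card {j. \<tau> \<le> \<bar>t j\<bar>} = a")
    case True
    have "M = span (e2 ` {j. \<tau> \<le> \<bar>t j\<bar>})"
      using M(1) True high(1) S(2) B.dim_span_basis[of "{j. \<tau> \<le> \<bar>t j\<bar>}"]
      by (intro subspace_dim_equal) (auto simp: is_flag_def N_def)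
    then show ?thesis by blast
  next
    case False
    have "M' = span (e2 ` {j. \<tau> \<le> \<bar>t j\<bar>})"
      using M(1) False \<tau> high(2) S(2) B.dim_span_basis[of "{j. \<tau> \<le> \<bar>t j\<bar>}"]
      by (intro subspace_dim_equal) (auto simp: is_flag_def N_def)
    then show ?thesis by blast
  qed
  ultimately show thesis using M by (intro that)
qed

text \<open>Each of the two intersections can be made trivial by its own pair of signs. One member
  of each flag is unaffected by the choice, so \<open>S\<close> is taken from the pair that treats
  the other member of the first flag, and \<open>R\<close> likewise for the second.\<close>

lemma homogeneous_flags_transversal:
  assumes M: "is_flag a M M'" "A.homogeneous M" "A.homogeneous M'"
      "(\<exists>K. M = span (e1 ` K)) \<or> (\<exists>K. M' = span (e1 ` K))"
    and P: "is_flag b P P'" "B.homogeneous P" "B.homogeneous P'"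
      "(\<exists>K. P = span (e2 ` K)) \<or> (\<exists>K. P' = span (e2 ` K))"
    and ab: "a + b + 1 = CARD('n)"
  obtains S R where "S \<in> {mat 1, F}" "R \<in> {mat 1, G}"
    "transversal ((*v) S ` M) ((*v) R ` P')" "transversal ((*v) S ` M') ((*v) R ` P)"
proof -
  have dims: "dim M + dim P' \<le> CARD('n)" "dim M' + dim P \<le> CARD('n)"
    using M(1) P(1) ab by (simp_all add: is_flag_def)
  obtain S1 R1 where 1: "S1 \<in> {mat 1, F}" "R1 \<in> {mat 1, G}" "transversal ((*v) S1 ` M) ((*v) R1 ` P')"
    using homogeneous_pair_transversal[OF M(2) P(3) dims(1)] .
  obtain S2 R2 where 2: "S2 \<in> {mat 1, F}" "R2 \<in> {mat 1, G}" "transversal ((*v) S2 ` M') ((*v) R2 ` P)"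
    using homogeneous_pair_transversal[OF M(3) P(2) dims(2)] .
  have invA: "(*v) S ` span (e1 ` K) = span (e1 ` K)" if "S \<in> {mat 1, F}" for S K
  proof (rule subspace_dim_equal)
    have S: "invertible S" using that invertible_fst by auto
    show "(*v) S ` span (e1 ` K) \<subseteq> span (e1 ` K)" using that A.span_basis_invariant[of K] by auto
    show "dim (span (e1 ` K)) \<le> dim ((*v) S ` span (e1 ` K))" by (simp only: dim_matrix_image[OF S])
  qed (simp_all add: subspace_matrix_image)
  have invB: "(*v) R ` span (e2 ` K) = span (e2 ` K)" if "R \<in> {mat 1, G}" for R K
  proof (rule subspace_dim_equal)
    have R: "invertible R" using that invertible_snd by auto
    show "(*v) R ` span (e2 ` K) \<subseteq> span (e2 ` K)" using that B.span_basis_invariant[of K] by auto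
    show "dim (span (e2 ` K)) \<le> dim ((*v) R ` span (e2 ` K))" by (simp only: dim_matrix_image[OF R])
  qed (simp_all add: subspace_matrix_image)
  show thesis
    using M(4)
  proof
    assume "\<exists>K. M = span (e1 ` K)"
    then have MS: "(*v) S ` M = M" if "S \<in> {mat 1, F}" for S using invA[OF that] by blast
    show thesis
      using P(4)
    proof
      assume "\<exists>K. P = span (e2 ` K)"
      then have "(*v) R ` P = P" if "R \<in> {mat 1, G}" for R using invB[OF that] by blast
      then show thesis using that[OF 2(1) 1(2)] 1 2 MS by simp
    next
      assume "\<exists>K. P' = span (e2 ` K)"
      then have "(*v) R ` P' = P'" if "R \<in> {mat 1, G}" for R using invB[OF that] by blast
      then show thesis using that[OF 2(1) 2(2)] 1 2 MS by simp
    qed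
  next
    assume "\<exists>K. M' = span (e1 ` K)"
    then have MS: "(*v) S ` M' = M'" if "S \<in> {mat 1, F}" for S using invA[OF that] by blast
    show thesis
      using P(4)
    proof
      assume "\<exists>K. P = span (e2 ` K)"
      then have "(*v) R ` P = P" if "R \<in> {mat 1, G}" for R using invB[OF that] by blast
      then show thesis using that[OF 1(1) 1(2)] 1 2 MS by simp
    next
      assume "\<exists>K. P' = span (e2 ` K)"
      then have "(*v) R ` P' = P'" if "R \<in> {mat 1, G}" for R using invB[OF that] by blast
      then show thesis using that[OF 1(1) 2(2)] 1 2 MS by simp
    qed
  qed
qed

text \<open>The flag of \<open>V\<close> is moved forward to a limit \<open>M\<close> adapted to
  \<open>F\<close>, the flag of \<open>U\<close> backward by inverse words to a limit
  \<open>P\<close> adapted to \<open>G\<close>. Once these limits are made transversal,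
  \<open>reaches\<close> carries the result back to \<open>U\<close> and then to
  \<open>V\<close>.\<close>

lemma transversal_element:
  assumes V: "is_flag a V V'" and U: "is_flag b U U'" and ab: "a + b + 1 = CARD('n)"
    and Q: "mat 1 \<in> Q" "\<And>S T. S \<in> Q \<Longrightarrow> T \<in> Q \<Longrightarrow> S ** T \<in> Q" "F \<in> Q" "G \<in> Q"
      "\<And>S. S \<in> Q \<Longrightarrow> invertible S"
  obtains S where "S \<in> Q" "transversal ((*v) S ` V) U'" "transversal ((*v) S ` V') U"
proof -
  interpret swap: eigenbasis_pair G e2 t C2 F e1 lam C1 by (rule swap)
  interpret mixed: eigenbasis_pair F e1 lam C1 "matrix_inv G" e2 "\<lambda>i. inverse (t i)" C2
    by (rule inverse_snd)
  interpret inverse: eigenbasis_pair "matrix_inv F" e1 "\<lambda>i. inverse (lam i)" C1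
      "matrix_inv G" e2 "\<lambda>i. inverse (t i)" C2
    by (rule eigenbasis_pair.swap[OF eigenbasis_pair.inverse_snd[OF mixed.swap]])
  obtain M M' where M: "is_flag a M M'" "A.homogeneous M" "A.homogeneous M'"
      "(\<exists>K. M = span (e1 ` K)) \<or> (\<exists>K. M' = span (e1 ` K))"
    and reachM: "reaches Q V V' M M'"
    using swap.reaches_flag_with_invariant_part[OF V Q(1,2,4,3,5)] .
  have Q': "mat 1 \<in> matrix_inv ` Q" "matrix_inv F \<in> matrix_inv ` Q" "matrix_inv G \<in> matrix_inv ` Q"
      "\<And>S. S \<in> matrix_inv ` Q \<Longrightarrow> invertible S"
    using image_eqI[of "mat 1" matrix_inv, OF matrix_inv_mat_1[symmetric] Q(1)] Q(3,4) invertible_matrix_inv[OF Q(5)] by auto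
  have Q'_mult: "S ** T \<in> matrix_inv ` Q" if ST: "S \<in> matrix_inv ` Q" "T \<in> matrix_inv ` Q" for S T
  proof -
    obtain S' T' where "S' \<in> Q" "S = matrix_inv S'" "T' \<in> Q" "T = matrix_inv T'" using ST by blast
    then show ?thesis
      using matrix_inv_mult_distrib[OF Q(5) Q(5), of T' S'] Q(2) by (intro image_eqI[of _ _ "T' ** S'"]) auto
  qed
  obtain P P' where P: "is_flag b P P'" "mixed.B.homogeneous P" "mixed.B.homogeneous P'"
      "(\<exists>K. P = span (e2 ` K)) \<or> (\<exists>K. P' = span (e2 ` K))"
    and reachP: "reaches (matrix_inv ` Q) U U' P P'"
    using inverse.reaches_flag_with_invariant_part[OF U Q'(1) Q'_mult Q'(2,3,4)] .
  obtain S R where SR: "S \<in> {mat 1, F}" "R \<in> {mat 1, matrix_inv G}"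
    and tr: "transversal ((*v) S ` M) ((*v) R ` P')" "transversal ((*v) S ` M') ((*v) R ` P)"
    using mixed.homogeneous_flags_transversal[OF M P ab] .
  have SQ: "S \<in> Q" using SR(1) Q(1,3) by auto
  have invR: "invertible R" using SR(2) mixed.invertible_snd by auto
  have RQ: "matrix_inv R \<in> Q"
    using SR(2) Q(1,4) by (auto simp: matrix_inv_mat_1 matrix_inv_inv[OF invertible_snd])
  \<comment> \<open>\<open>R\<close> is 1 or the inverse of \<open>G\<close>; moving it to the other
    side gives an element of \<open>Q\<close> again.\<close>
  let ?T = "matrix_inv R ** S"
  have TQ: "?T \<in> Q" using RQ SQ by (rule Q(2))
  have "subspace M" "subspace M'" using M(1) by (auto simp: is_flag_def)
  then have sub: "subspace ((*v) ?T ` M)" "subspace ((*v) ?T ` M')" by (simp_all add: subspace_matrix_image)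
  have "transversal P ((*v) ?T ` M')" "transversal P' ((*v) ?T ` M)"
    using tr transversal_image_iff[OF invR, of P "(*v) S ` M'"] transversal_image_iff[OF invR, of P' "(*v) S ` M"]
    by (simp_all add: image_matrix_mult Int_commute)
  then obtain Z' where Z': "Z' \<in> matrix_inv ` Q"
      "transversal ((*v) Z' ` U) ((*v) ?T ` M')" "transversal ((*v) Z' ` U') ((*v) ?T ` M)"
    using reachesE[OF reachP sub(2,1)] by metis
  then obtain Z where Z: "Z \<in> Q" "Z' = matrix_inv Z" by blast
  have ZTQ: "Z ** ?T \<in> Q" using Z(1) TQ by (rule Q(2))
  let ?i = "(*v) (matrix_inv (Z ** ?T))"
  have "transversal ((*v) (Z ** ?T) ` M) U'" "transversal ((*v) (Z ** ?T) ` M') U"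
    unfolding image_matrix_mult[of Z] transversal_image_iff[OF Q(5)[OF Z(1)]]
    using Z'(2,3) by (simp_all add: Z(2) Int_commute)
  then have "transversal M (?i ` U')" "transversal M' (?i ` U)"
    unfolding transversal_image_iff[OF Q(5)[OF ZTQ]] by blast+
  moreover have "subspace (?i ` U')" "subspace (?i ` U)"
    using U by (auto simp: is_flag_def subspace_matrix_image)
  ultimately obtain Y where Y: "Y \<in> Q" "transversal ((*v) Y ` V) (?i ` U')" "transversal ((*v) Y ` V') (?i ` U)"
    using reachesE[OF reachM] by metis
  show thesis
  proof (rule that)
    show "(Z ** ?T) ** Y \<in> Q" using ZTQ Y(1) by (rule Q(2))
    show "transversal ((*v) ((Z ** ?T) ** Y) ` V) U'" "transversal ((*v) ((Z ** ?T) ** Y) ` V') U"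
      unfolding image_matrix_mult[of "Z ** ?T" Y] transversal_image_iff[OF Q(5)[OF ZTQ]] by (rule Y(2,3))+
  qed
qed

end

section \<open>Words transversal to a given flag\<close>

lemma eigenvectors_independent:
  fixes e :: "'i \<Rightarrow> real^'n"
  assumes "finite I" "inj_on lam I" "\<And>i. F *v e i = lam i *\<^sub>R e i" "\<And>i. e i \<noteq> 0"
    and "(\<Sum>i\<in>I. c i *\<^sub>R e i) = 0" and "i \<in> I"
  shows "c i = 0"
  using assms(1,2,5,6)
proof (induction I arbitrary: c i rule: finite_induct)
  case (insert s I)
  have sum: "c s *\<^sub>R e s + (\<Sum>i\<in>I. c i *\<^sub>R e i) = 0" using insert by simp
  then have "F *v (c s *\<^sub>R e s + (\<Sum>i\<in>I. c i *\<^sub>R e i)) = 0" by simp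
  then have "(c s * lam s) *\<^sub>R e s + (\<Sum>i\<in>I. (c i * lam i) *\<^sub>R e i) = 0"
    by (simp add: matrix_vector_right_distrib linear_sum[OF matrix_vector_mul_linear]
        matrix_vector_mult_scaleR assms(3))
  moreover have "lam s *\<^sub>R (c s *\<^sub>R e s + (\<Sum>i\<in>I. c i *\<^sub>R e i)) = 0" using sum by simp
  ultimately have "(\<Sum>i\<in>I. (c i * lam i) *\<^sub>R e i) - lam s *\<^sub>R (\<Sum>i\<in>I. c i *\<^sub>R e i) = 0"
    by (simp add: scaleR_right_distrib mult.commute add_eq_0_iff)
  then have "(\<Sum>i\<in>I. (c i * (lam i - lam s)) *\<^sub>R e i) = 0"
    by (simp add: scaleR_sum_right right_diff_distrib scaleR_left_diff_distrib sum_subtractf mult.commute)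
  then have "c i * (lam i - lam s) = 0" if "i \<in> I" for i
    using insert.IH[of "\<lambda>i. c i * (lam i - lam s)"] insert.prems(1) that by auto
  moreover have "lam i \<noteq> lam s" if "i \<in> I" for i
    using insert.prems(1) insert.hyps(2) that by (auto simp: inj_on_def)
  ultimately have I0: "c i = 0" if "i \<in> I" for i using that by simp
  then have "c s *\<^sub>R e s = 0" using sum by simp
  then have "c s = 0" using assms(4) by simp
  with I0 insert.prems show ?case by auto
qed simp

lemma eigenbasis_exists:
  fixes F :: "real^'n^'n"
  assumes inv: "invertible F" and inj: "inj lam"
    and eig: "\<And>i. F *v e i = lam i *\<^sub>R e i" and norm: "\<And>i. norm (e i) = 1"
    and prods: "\<And>I J. card I = card J \<Longrightarrow> 1 \<le> card I \<Longrightarrow> I \<noteq> J \<Longrightarrow> prod lam I \<noteq> prod lam J"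
  obtains C where "eigenbasis F e lam C"
proof -
  have e_nz: "e i \<noteq> 0" for i using norm[of i] by auto
  have lam_nz: "lam i \<noteq> 0" for i
  proof
    assume "lam i = 0"
    then have "F *v e i = 0" by (simp add: eig)
    then have "e i = 0" using matrix_inv_apply(1)[OF inv, of "e i"] by simp
    with e_nz show False by blast
  qed
  \<comment> \<open>The columns of \<open>P\<close> are the eigenvectors, so the rows of its inverse
    are the coordinate functionals.\<close>
  define P where "P = (\<chi> r c. e c $ r)"
  have P_mult: "P *v x = (\<Sum>j\<in>UNIV. (x $ j) *\<^sub>R e j)" for x
    by (simp add: P_def matrix_vector_mult_def Finite_Cartesian_Product.vec_eq_iff mult.commute)
  have "x = 0" if "P *v x = 0" for x
  proof -
    have "(\<Sum>j\<in>UNIV. (x $ j) *\<^sub>R e j) = 0" using that by (simp only: P_mult)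
    then have "x $ j = 0" for j
      by (rule eigenvectors_independent[OF finite inj eig e_nz _ UNIV_I])
    then show ?thesis by (simp add: Finite_Cartesian_Product.vec_eq_iff)
  qed
  then have "invertible P"
    by (metis invertible_left_inverse matrix_left_invertible_ker)
  note P_inv = matrix_inv_apply[OF this]
  define C where "C j x = (matrix_inv P *v x) $ j" for j x
  have "eigenbasis F e lam C"
  proof (rule eigenbasis.intro)
    show "linear (C j)" for j
      unfolding C_def by (rule linearI) (simp_all add: matrix_vector_right_distrib matrix_vector_mult_scaleR)
    show "x = (\<Sum>j\<in>UNIV. C j x *\<^sub>R e j)" for x
      using P_inv(2)[of x] by (simp add: P_mult C_def)
    show "C j (e k) = (if j = k then 1 else 0)" for j k
    proof -
      have "P *v axis k 1 = e k"
        by (simp add: P_mult axis_def if_distrib[of "\<lambda>r. r *\<^sub>R _"] cong: if_cong)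
      then show ?thesis using P_inv(1)[of "axis k 1"] by (simp add: C_def axis_def)
    qed
    show "{i, j} = {k, l}" if ij: "\<bar>lam i\<bar> = \<bar>lam j\<bar>" "i \<noteq> j" and kl: "\<bar>lam k\<bar> = \<bar>lam l\<bar>" "k \<noteq> l" for i j k l
    proof -
      have lj: "lam j = - lam i" using ij inj by (metis abs_eq_iff add.inverse_inverse injD)
      have ll: "lam l = - lam k" using kl inj by (metis abs_eq_iff add.inverse_inverse injD)
      show ?thesis
      proof (cases "{i, j} \<inter> {k, l} = {}")
        case True
        \<comment> \<open>Two disjoint pairs of opposite eigenvalues would give equal products of
          size 2, as the two signs cancel.\<close>
        have "prod lam {i, k} = prod lam {j, l}" using True lj ll by auto
        moreover have "card {i, k} = card {j, l}" "1 \<le> card {i, k}" using True by auto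
        moreover have "{i, k} \<noteq> {j, l}" using True ij(2) by auto
        ultimately show ?thesis using prods by blast
      next
        case False
        then consider "i = k" | "i = l" | "j = k" | "j = l" by auto
        then show ?thesis
        proof cases
          case 1
          then have "j = l" using lj ll inj by (metis injD)
          with 1 show ?thesis by simp
        next
          case 2
          then have "lam j = lam k" using lj ll by simp
          then have "j = k" using inj by (metis injD)
          with 2 show ?thesis by auto
        next
          case 3
          then have "lam i = lam l" using lj ll by simp
          then have "i = l" using inj by (metis injD)
          with 3 show ?thesis by auto
        next
          case 4
          then have "lam i = lam k" using lj ll by simp
          then have "i = k" using inj by (metis injD)
          with 4 show ?thesis by simp
        qed
      qed
    qed
  qed (use eig lam_nz inj in auto)
  then show thesis by (rule that)
qed

text \<open>The coordinates of a common vector in \<open>e2\<close> vanish outside \<open>K\<close>.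
  Choosing as many indices there as \<open>I\<close> has elements gives a homogeneous square system
  for its coordinates in \<open>e1\<close>, whose determinant is a minor of
  \<open>A\<close>.\<close>

lemma coordinate_spans_transversal:
  fixes A :: "real^'n^'n"
  assumes "eigenbasis F e1 lam C1" "eigenbasis G e2 t C2"
    and A: "\<And>i. e1 i = (\<Sum>j\<in>UNIV. (A $ j $ i) *\<^sub>R e2 j)" and minors: "all_minors_nonzero A"
    and card: "card I + card K \<le> CARD('n)"
  shows "transversal (span (e1 ` I)) (span (e2 ` K))"
proof clarify
  interpret A: eigenbasis F e1 lam C1 by fact
  interpret B: eigenbasis G e2 t C2 by fact
  fix x assume x: "x \<in> span (e1 ` I)" "x \<in> span (e2 ` K)"
  have "card (- K) \<ge> card I" using card card_Diff_subset[of K UNIV] by (simp add: Compl_eq_Diff_UNIV)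
  then obtain J where J: "J \<subseteq> - K" "card J = card I" by (metis obtain_subset_with_card_n)
  have bij: "bij_betw (enum_set I) {..<card I} I" "bij_betw (enum_set J) {..<card I} J"
    using bij_betw_enum_set[of I] bij_betw_enum_set[of J] J(2) by simp_all
  have x_sum: "x = (\<Sum>i\<in>I. C1 i x *\<^sub>R e1 i)"
    using x(1) by (intro A.coord_eqI) (auto simp: A.coord_basis_sum A.mem_span_basis)
  have nz: "ldet (card I) (\<lambda>i j. A $ enum_set J i $ enum_set I j) \<noteq> 0"
    using minors bij unfolding all_minors_nonzero_def by (auto simp: bij_betw_def)
  have "(\<Sum>j<card I. A $ enum_set J i $ enum_set I j * C1 (enum_set I j) x) = 0" if i: "i < card I" for i
  proof -
    have "enum_set J i \<notin> K" using bij_betwE[OF bij(2)] i J(1) by auto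
    then have "0 = C2 (enum_set J i) x" using x(2) by (simp add: B.mem_span_basis)
    also have "\<dots> = (\<Sum>k\<in>I. C1 k x * C2 (enum_set J i) (e1 k))"
      by (subst x_sum) (simp add: B.coord_sum)
    also have "\<dots> = (\<Sum>k\<in>I. A $ enum_set J i $ k * C1 k x)"
      by (simp add: A B.coord_basis_sum mult.commute)
    also have "\<dots> = (\<Sum>j<card I. A $ enum_set J i $ enum_set I j * C1 (enum_set I j) x)"
      by (rule sum.reindex_bij_betw[OF bij(1), symmetric])
    finally show ?thesis by simp
  qed
  then have "\<forall>j<card I. C1 (enum_set I j) x = 0"
    using nz[unfolded ldet_nonzero_iff_cols, THEN spec[of _ "\<lambda>j. C1 (enum_set I j) x"]] by simp
  then have "C1 i x = 0" if "i \<in> I" for i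
    using that bij_betw_imp_surj_on[OF bij(1)] by force
  then show "x = 0" using x_sum by simp
qed

section \<open>From transversal flags to words of bounded length\<close>

lemma foldr_matrix_mult: "foldr (**) ts M = foldr (**) ts (mat 1) ** (M :: real^'n^'n)"
  by (induction ts) (simp_all add: matrix_mul_assoc)

lemma invertible_word:
  fixes F G :: "real^'n^'n"
  assumes "invertible F" "invertible G" "set ts \<subseteq> {F, G}"
  shows "invertible (foldr (**) ts (mat 1))"
  using assms(3)
proof (induction ts)
  case (Cons T ts)
  then have "invertible T" using assms(1,2) by auto
  with Cons show ?case by (simp add: invertible_mult)
qed simp

lemma lin_indep_act:
  assumes "invertible S" "lin_indep n v"
  shows "lin_indep n (act S v)"
proof -
  have "act S v ` {..<n} = (*v) S ` (v ` {..<n})" by (auto simp: act_def)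
  then show ?thesis using assms by (simp add: lin_indep_iff_dim dim_matrix_image)
qed

lemma dim_orthogonal_to_tuple:
  fixes w :: "nat \<Rightarrow> real^'n"
  assumes "lin_indep n w"
  shows "dim {x. \<forall>j<n. x \<bullet> w j = 0} + n = CARD('n)"
proof -
  have "{y \<in> UNIV. \<forall>x\<in>span (w ` {..<n}). orthogonal x y} = {x. \<forall>j<n. x \<bullet> w j = 0}"
  proof (rule Set.set_eqI)
    fix y
    have "(\<forall>x\<in>span (w ` {..<n}). orthogonal x y) \<longleftrightarrow> (\<forall>x\<in>w ` {..<n}. orthogonal x y)"
      using orthogonal_to_span[where x = y and S = "w ` {..<n}"] span_base[of _ "w ` {..<n}"]
      by (auto simp: orthogonal_commute[of _ y])
    also have "\<dots> \<longleftrightarrow> (\<forall>j<n. y \<bullet> w j = 0)"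
      by (auto simp: real_inner_class.orthogonal_def inner_commute[of y])
    finally show "y \<in> {y \<in> UNIV. \<forall>x\<in>span (w ` {..<n}). orthogonal x y} \<longleftrightarrow> y \<in> {x. \<forall>j<n. x \<bullet> w j = 0}"
      by simp
  qed
  then show ?thesis
    using dim_subspace_orthogonal_to_vectors[of "span (w ` {..<n})" UNIV] assms
    by (simp add: lin_indep_iff_dim)
qed

context eigenbasis_pair
begin

text \<open>The pairing of \<open>S v\<close> with \<open>w\<close> is nonzero when the image of the
  span of \<open>v\<close> avoids the orthogonal complement \<open>U n\<close> of the first
  \<open>n\<close> vectors of \<open>w\<close>. These complements decrease with \<open>n\<close>, so
  the second flag is \<open>U (Suc m)\<close> inside \<open>U m\<close>.\<close>

lemma transversal_word:
  fixes v w :: "nat \<Rightarrow> real^'n"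
  assumes v: "lin_indep (Suc m) v" and w: "lin_indep (Suc m) w"
  shows "\<exists>ts. set ts \<subseteq> {F, G} \<and> wedge_inner m (act (foldr (**) ts (mat 1)) v) w \<noteq> 0 \<and>
    wedge_inner (Suc m) (act (foldr (**) ts (mat 1)) v) w \<noteq> 0"
proof -
  define Q where "Q = {foldr (**) ts (mat 1) | ts. set ts \<subseteq> {F, G}}"
  define V where "V n = span (v ` {..<n})" for n
  define U where "U n = {x. \<forall>j<n. x \<bullet> w j = 0}" for n
  have v': "lin_indep m v" and w': "lin_indep m w" using v w by (auto dest: lin_indep_SucD)
  have dims: "dim (U m) + m = CARD('n)" "dim (U (Suc m)) + Suc m = CARD('n)"
    using dim_orthogonal_to_tuple[OF w'] dim_orthogonal_to_tuple[OF w] by (simp_all add: U_def)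
  have flV: "is_flag m (V m) (V (Suc m))"
    using v v' by (auto simp: is_flag_def V_def lin_indep_iff_dim intro: span_mono[THEN subsetD, rotated])
  have subU: "subspace (U n)" for n by (auto simp: U_def subspace_def inner_left_distrib)
  have flU: "is_flag (CARD('n) - Suc m) (U (Suc m)) (U m)"
    using dims subU by (auto simp: is_flag_def U_def)
  have invQ: "invertible S" if "S \<in> Q" for S
    using that invertible_word[OF invertible_fst invertible_snd] by (auto simp: Q_def)
  have Q1: "mat 1 \<in> Q" unfolding Q_def by (intro CollectI exI[of _ "[]"]) simp
  have Q_mult: "S ** T \<in> Q" if "S \<in> Q" "T \<in> Q" for S T
  proof -
    obtain ss ts where "set ss \<subseteq> {F, G}" "S = foldr (**) ss (mat 1)"
      "set ts \<subseteq> {F, G}" "T = foldr (**) ts (mat 1)" using \<open>S \<in> Q\<close> \<open>T \<in> Q\<close> by (auto simp: Q_def)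
    then show ?thesis
      unfolding Q_def by (intro CollectI exI[of _ "ss @ ts"]) (simp add: foldr_matrix_mult[of ss "foldr _ _ _"])
  qed
  have FQ: "F \<in> Q" unfolding Q_def by (intro CollectI exI[of _ "[F]"]) simp
  have GQ: "G \<in> Q" unfolding Q_def by (intro CollectI exI[of _ "[G]"]) simp
  have ab: "m + (CARD('n) - Suc m) + 1 = CARD('n)" using dims(2) by simp
  obtain S where S: "S \<in> Q" "transversal ((*v) S ` V m) (U m)"
      "transversal ((*v) S ` V (Suc m)) (U (Suc m))"
    using transversal_element[OF flV flU ab Q1 Q_mult FQ GQ invQ] .
  have "wedge_inner n (act S v) w \<noteq> 0"
    if n: "lin_indep n v" "transversal ((*v) S ` V n) (U n)" for n
  proof (rule wedge_inner_nonzeroI)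
    show "lin_indep n (act S v)" by (rule lin_indep_act[OF invQ[OF S(1)] n(1)])
    have "act S v ` {..<n} = (*v) S ` (v ` {..<n})" by (auto simp: act_def)
    then have "span (act S v ` {..<n}) = (*v) S ` V n"
      by (simp add: V_def linear_span_image[OF matrix_vector_mul_linear])
    then show "x = 0" if "x \<in> span (act S v ` {..<n})" "\<And>j. j < n \<Longrightarrow> x \<bullet> w j = 0" for x
      using that n(2) by (auto simp: U_def)
  qed
  then have "wedge_inner m (act S v) w \<noteq> 0" "wedge_inner (Suc m) (act S v) w \<noteq> 0"
    using v v' S(2,3) by blast+
  then show ?thesis using S(1) by (auto simp: Q_def)
qed

text \<open>The shortened word may be empty, which \<open>Sk\<close> excludes. It is therefore
  sought for \<open>act F v\<close>, and the extra letter \<open>F\<close> is appended; this costs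
  one unit of length, whence the strict bound on \<open>k\<close>.\<close>

lemma transversal_word_in_Sk:
  fixes v w :: "nat \<Rightarrow> real^'n"
  assumes v: "lin_indep (Suc m) v" and w: "lin_indep (Suc m) w"
    and k: "(CARD('n) choose m) * (CARD('n) choose Suc m) < k"
  shows "\<exists>S\<in>Sk k F G. wedge_inner m (act S v) w \<noteq> 0 \<and> wedge_inner (Suc m) (act S v) w \<noteq> 0"
proof -
  obtain ts where "set ts \<subseteq> {F, G}" "wedge_inner m (act (foldr (**) ts (mat 1)) (act F v)) w \<noteq> 0"
      "wedge_inner (Suc m) (act (foldr (**) ts (mat 1)) (act F v)) w \<noteq> 0"
    using transversal_word[OF lin_indep_act[OF invertible_fst v] w] by blast
  then obtain us where us: "set us \<subseteq> {F, G}" "length us < k"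
      "wedge_inner m (act (foldr (**) us (mat 1)) (act F v)) w \<noteq> 0"
      "wedge_inner (Suc m) (act (foldr (**) us (mat 1)) (act F v)) w \<noteq> 0"
    using transversal_short_word[of ts "{F, G}" m "act F v" w] k le_less_trans by blast
  have word: "foldr (**) (us @ [F]) (mat 1) = foldr (**) us (mat 1) ** F"
    by (simp add: foldr_matrix_mult[of us F])
  have "foldr (**) (us @ [F]) (mat 1) \<in> Sk k F G"
    unfolding Sk_def using us(1,2) by (intro CollectI exI[of _ "us @ [F]"]) auto
  moreover have "act (foldr (**) (us @ [F]) (mat 1)) v = act (foldr (**) us (mat 1)) (act F v)"
    unfolding word by (rule act_mult)
  ultimately show ?thesis using us(3,4) by (intro bexI[of _ "foldr (**) (us @ [F]) (mat 1)"]) simp_all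
qed

lemma condC_frac_Sk:
  assumes "(CARD('n) choose m) * (CARD('n) choose Suc m) < k"
  shows "condC_frac (Sk k F G) m"
  unfolding condC_frac_def
proof (intro allI impI)
  fix v w :: "nat \<Rightarrow> real^'n" and x y
  assume "wedge_nonzero m v \<and> wedge_nonzero m w \<and>
    wedge_nonzero (Suc m) (v(m := x)) \<and> wedge_nonzero (Suc m) (w(m := y))"
  then obtain S where S: "S \<in> Sk k F G" "wedge_inner m (act S (v(m := x))) (w(m := y)) \<noteq> 0"
      "wedge_inner (Suc m) (act S (v(m := x))) (w(m := y)) \<noteq> 0"
    using transversal_word_in_Sk[OF _ _ assms] unfolding wedge_nonzero_iff_lin_indep by blast
  have "wedge_inner m (act S (v(m := x))) (w(m := y)) = wedge_inner m (act S v) w"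
    unfolding wedge_inner_def by (rule ldet_cong) (simp add: act_def)
  with S show "\<exists>S\<in>Sk k F G. wedge_inner m (act S v) w \<noteq> 0 \<and>
      wedge_inner (Suc m) (act S (v(m := x))) (w(m := y)) \<noteq> 0" by metis
qed

end

section \<open>Integral exponents and the conclusion\<close>

lemma lin_indep_extend:
  fixes v :: "nat \<Rightarrow> real^'n"
  assumes "lin_indep m v" "m < CARD('n)"
  obtains x where "lin_indep (Suc m) (v(m := x))"
proof -
  have "span (v ` {..<m}) \<noteq> UNIV"
  proof
    assume "span (v ` {..<m}) = UNIV"
    then have "dim (v ` {..<m}) = CARD('n)" by (metis dim_span dim_UNIV DIM_cart DIM_real mult.right_neutral)
    with assms show False by (simp add: lin_indep_iff_dim)
  qed
  then obtain x where x: "x \<notin> span (v ` {..<m})" by blast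
  have "v(m := x) ` {..<m} = v ` {..<m}" by auto
  then have "v(m := x) ` {..<Suc m} = insert x (v ` {..<m})"
    unfolding lessThan_Suc image_insert by simp
  then have "lin_indep (Suc m) (v(m := x))"
    using x assms(1) unfolding lin_indep_iff_dim by (simp only: dim_insert) simp
  then show thesis by (rule that)
qed

lemma condC_int_if_condC_frac:
  fixes Fam :: "(real^'n^'n) set"
  assumes "condC_frac Fam m" "m < CARD('n)"
  shows "condC_int Fam m"
  unfolding condC_int_def
proof (intro allI impI)
  fix v w :: "nat \<Rightarrow> real^'n" assume vw: "wedge_nonzero m v \<and> wedge_nonzero m w"
  then obtain x y where "wedge_nonzero (Suc m) (v(m := x))" "wedge_nonzero (Suc m) (w(m := y))"
    using lin_indep_extend[of m v] lin_indep_extend[of m w] assms(2)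
    unfolding wedge_nonzero_iff_lin_indep by metis
  then show "\<exists>S\<in>Fam. wedge_inner m (act S v) w \<noteq> 0"
    using assms(1) vw unfolding condC_frac_def by blast
qed

text \<open>In top degree no further vector can be adjoined, but there the orthogonal complement is
  0 and any invertible member suffices.\<close>

lemma condC_int_full:
  fixes F :: "real^'n^'n"
  assumes "invertible F" "F \<in> Fam"
  shows "condC_int Fam CARD('n)"
  unfolding condC_int_def wedge_nonzero_iff_lin_indep
proof (intro allI impI)
  fix v w :: "nat \<Rightarrow> real^'n" assume vw: "lin_indep CARD('n) v \<and> lin_indep CARD('n) w"
  have "wedge_inner CARD('n) (act F v) w \<noteq> 0"
  proof (rule wedge_inner_nonzeroI)
    show "lin_indep CARD('n) (act F v)" using vw lin_indep_act[OF assms(1)] by blast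
    have "dim {x. \<forall>j<CARD('n). x \<bullet> w j = 0} = 0" using dim_orthogonal_to_tuple[of "CARD('n)" w] vw by simp
    then show "x = 0" if "\<And>j. j < CARD('n) \<Longrightarrow> x \<bullet> w j = 0" for x
      using that by (auto simp: dim_eq_0)
  qed
  with assms(2) show "\<exists>S\<in>Fam. wedge_inner CARD('n) (act S v) w \<noteq> 0" by blast
qed

theorem mainTheorem6:
  fixes F G A :: "real^'n^'n"
    and lam t :: "'n \<Rightarrow> real"
    and e1 e2 :: "'n \<Rightarrow> real^'n"
  assumes "invertible F" and "invertible G"
    and "inj lam" and "inj t"
    and "\<And>i. F *v e1 i = lam i *\<^sub>R e1 i" and "\<And>i. norm (e1 i) = 1"
    and "\<And>i. G *v e2 i = t i *\<^sub>R e2 i" and "\<And>i. norm (e2 i) = 1"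
    and "\<And>I J. card I = card J \<Longrightarrow> 1 \<le> card I \<Longrightarrow> I \<noteq> J \<Longrightarrow> prod lam I \<noteq> prod lam J"
    and "\<And>I J. card I = card J \<Longrightarrow> 1 \<le> card I \<Longrightarrow> I \<noteq> J \<Longrightarrow> prod t I \<noteq> prod t J"
    and "\<And>i. e1 i = (\<Sum>j\<in>UNIV. (A $ j $ i) *\<^sub>R e2 j)"
    and "all_minors_nonzero A"
  shows "\<forall>s::real. 0 \<le> s \<and> s \<le> real CARD('n) \<longrightarrow>
           condC (Sk (2 * (Max {CARD('n) choose m | m. m \<le> CARD('n)})\<^sup>2) F G) s"
proof (intro allI impI)
  fix s :: real assume s: "0 \<le> s \<and> s \<le> real CARD('n)"
  obtain C1 where C1: "eigenbasis F e1 lam C1"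
    using eigenbasis_exists[OF assms(1,3,5,6,9)] by blast
  obtain C2 where C2: "eigenbasis G e2 t C2"
    using eigenbasis_exists[OF assms(2,4,7,8,10)] by blast
  interpret eigenbasis_pair F e1 lam C1 G e2 t C2
    by (rule eigenbasis_pair.intro[OF C1 C2 eigenbasis_pair_axioms.intro[OF
          coordinate_spans_transversal[OF C1 C2 assms(11,12)] assms(1,2)]])
  let ?B = "{CARD('n) choose m | m. m \<le> CARD('n)}"
  have finB: "finite ?B" by simp
  have choose_le: "CARD('n) choose m \<le> Max ?B" for m
  proof (cases "m \<le> CARD('n)")
    case True
    then show ?thesis using finB by (intro Max_ge) auto
  qed (simp add: binomial_eq_0)
  have pos: "1 \<le> Max ?B" using choose_le[of 0] by simp
  \<comment> \<open>The factor 2 leaves room for the additional letter, since the maximum is at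
    least 1.\<close>
  have k: "(CARD('n) choose m) * (CARD('n) choose Suc m) < 2 * (Max ?B)\<^sup>2" for m
  proof -
    have "(CARD('n) choose m) * (CARD('n) choose Suc m) \<le> (Max ?B)\<^sup>2"
      unfolding power2_eq_square by (intro mult_le_mono choose_le)
    also have "\<dots> < 2 * (Max ?B)\<^sup>2" using pos by simp
    finally show ?thesis .
  qed
  have frac: "condC_frac (Sk (2 * (Max ?B)\<^sup>2) F G) m" for m
    using k by (rule condC_frac_Sk)
  have "1 \<le> 2 * (Max ?B)\<^sup>2" using k[of 0] by simp
  then have "F \<in> Sk (2 * (Max ?B)\<^sup>2) F G"
    unfolding Sk_def by (intro CollectI exI[of _ "[F]"]) simp
  then have full: "condC_int (Sk (2 * (Max ?B)\<^sup>2) F G) CARD('n)"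
    using assms(1) by (intro condC_int_full)
  have "nat \<lfloor>s\<rfloor> \<le> CARD('n)" using s by linarith
  then have "condC_int (Sk (2 * (Max ?B)\<^sup>2) F G) (nat \<lfloor>s\<rfloor>)"
    using full condC_int_if_condC_frac[OF frac, of "nat \<lfloor>s\<rfloor>"] by (cases "nat \<lfloor>s\<rfloor> = CARD('n)") simp_all
  then show "condC (Sk (2 * (Max ?B)\<^sup>2) F G) s"
    using frac unfolding condC_def by simp
qed

end
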